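(* Let $D=(-1,1)$, let $\varrho$ be the uniform probability measure on $D$ (i.e. $\mathrm{d}\varrho(x)=\frac12\mathrm{d}x$), let $n\in\mathbb{N}$ and let $\mathcal{P}=\mathbb{P}_{n-1}$ be the space of (complex) algebraic polynomials of degree less than $n$. Let $c:(-1,1)\to(0,\infty)$ be a (measurable) cost function satisfying $c(x)\lesssim(1-x^2)^{-\alpha}$, $x\in(-1,1)$, for some $\alpha\geq0$. Define the sampling measure $$\mathrm{d}\mu(x)=\frac{(1-x^2)^{\beta}\,\mathrm{d}x}{\int_{-1}^1(1-x^2)^{\beta}\,\mathrm{d}x},$$ where $\beta=-1/2$ if $0\leq\alpha<1/2$ and $\beta=\alpha-1+\delta$ if $\alpha\geq1/2$, with $\delta>0$ arbitrary. Let $w=1/v$, $v=\mathrm{d}\mu/\mathrm{d}\varrho$. Let $f\in L^2_{\varrho}(D)$ and $0<\epsilon<1$. Then there is a number of samples $m\geq n$ whose expected evaluation cost $C_{\mathsf{exp}}=m\int_D c(x)\,\mathrm{d}\mu(x)$ satisfies $$C_{\mathsf{exp}}\lesssim_{\alpha}n\cdot\log(3n/\epsilon)\quad\text{if }0\leq\alpha<1/2,\qquad C_{\mathsf{exp}}\lesssim_{\alpha,\delta}n^{2(\alpha+\delta)}\cdot\log(3n/\epsilon)\quad\text{if }\alpha\geq1/2,$$ and such that, for $x_1,\ldots,x_m$ drawn i.i.d. from $\mu$, the following holds with probability at least $1-\epsilon$. For any $e\in\mathbb{C}^m$, the weighted least-squares estimator $$\hat f\in\operatorname*{argmin}_{p\in\mathcal{P}}\frac1m\sum_{i=1}^m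 w(x_i)|y_i-p(x_i)|^2,\qquad y_i=f(x_i)+e_i,$$ is unique and satisfies $$\|f-\hat f\|_{L^2_{\varrho}(D)}\lesssim\frac{n}{\sqrt{\epsilon}}\left(\|f-f_n\|_{L^2_{\varrho}(D)}+\|e\|_2\right),$$ $$\|f-\hat f\|_{L^{\infty}_{\varrho}(D)}\lesssim\|f-f_n\|_{L^{\infty}_{\varrho}(D)}+\frac{n}{\sqrt{\epsilon}}\left(\|f-f_n\|_{L^2_{\varrho}(D)}+\|e\|_2\right),$$ where $f_n\in\mathcal{P}$ is the best approximation to $f$ from $\mathcal{P}$ in the $L^2_{\varrho}(D)$-norm.
   Context: Functions are complex-valued. $A\lesssim B$ means $A\leq C\,B$ for a constant $C>0$; in the error bounds the constant is universal, and in the bounds on $C_{\mathsf{exp}}$ the constant depends only on the parameters shown as subscripts (and on the implied constant in the hypothesis $c(x)\lesssim(1-x^2)^{-\alpha}$), in particular not on $n$, $\epsilon$ or $f$. The total cost is the random variable $C_{\mathsf{tot}}=c(x_1)+\cdots+c(x_m)$ and $C_{\mathsf{exp}}=\mathbb{E}(C_{\mathsf{tot}})=m\int_D c\,\mathrm{d}\mu$. $\|e\|_2$ is the Euclidean norm. *)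

theory Defs
  imports
    "HOL-Probability.Probability"
    "HOL-Computational_Algebra.Polynomial"
begin

definition D :: "real set" where
  "D = {-1<..<1}"

definition rho :: "real measure" where
  "rho = uniform_measure (restrict_space lborel D) D"

definition sampling_exponent :: "real \<Rightarrow> real \<Rightarrow> real" where
  "sampling_exponent \<alpha> \<delta> = (if \<alpha> < 1/2 then - 1/2 else \<alpha> - 1 + \<delta>)"

definition sampling_measure :: "real \<Rightarrow> real measure" where
  "sampling_measure \<beta> =
     density (restrict_space lborel D)
       (\<lambda>x. ennreal ((1 - x\<^sup>2) powr \<beta> / (LBINT t:D. (1 - t\<^sup>2) powr \<beta>)))"

definition weight :: "real measure \<Rightarrow> real \<Rightarrow> real" where
  "weight \<mu> x = 1 / enn2real (RN_deriv rho \<mu> x)"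

definition L2_space :: "'a measure \<Rightarrow> ('a \<Rightarrow> complex) set" where
  "L2_space M = {f \<in> borel_measurable M. integrable M (\<lambda>x. (cmod (f x))\<^sup>2)}"

definition L2_norm :: "'a measure \<Rightarrow> ('a \<Rightarrow> complex) \<Rightarrow> real" where
  "L2_norm M f = sqrt (\<integral>x. (cmod (f x))\<^sup>2 \<partial>M)"

text \<open>The essential supremum is extended-valued: a square-integrable function may be
  essentially unbounded.\<close>

definition Linf_norm :: "'a measure \<Rightarrow> ('a \<Rightarrow> complex) \<Rightarrow> ennreal" where
  "Linf_norm M f = esssup M (\<lambda>x. ennreal (cmod (f x)))"

definition polys :: "nat \<Rightarrow> complex poly set" where
  "polys n = {p. p = 0 \<or> degree p < n}"

definition poly_fun :: "complex poly \<Rightarrow> real \<Rightarrow> complex" where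
  "poly_fun p x = poly p (complex_of_real x)"

definition is_best_approximation :: "nat \<Rightarrow> (real \<Rightarrow> complex) \<Rightarrow> complex poly \<Rightarrow> bool" where
  "is_best_approximation n f p \<longleftrightarrow>
     is_arg_min (\<lambda>q. L2_norm rho (\<lambda>x. f x - poly_fun q x)) (\<lambda>q. q \<in> polys n) p"

definition is_wls_estimator ::
  "nat \<Rightarrow> (real \<Rightarrow> real) \<Rightarrow> nat \<Rightarrow> (nat \<Rightarrow> real) \<Rightarrow> (nat \<Rightarrow> complex) \<Rightarrow> complex poly \<Rightarrow> bool" where
  "is_wls_estimator n w m x y p \<longleftrightarrow>
     is_arg_min (\<lambda>q. 1 / real m * (\<Sum>i<m. w (x i) * (cmod (y i - poly_fun q (x i)))\<^sup>2))
       (\<lambda>q. q \<in> polys n) p"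

definition expected_cost :: "(real \<Rightarrow> real) \<Rightarrow> real measure \<Rightarrow> nat \<Rightarrow> ennreal" where
  "expected_cost c \<mu> m = of_nat m * (\<integral>\<^sup>+x. ennreal (c x) \<partial>\<mu>)"

end

(*
  The one-sided discrete norm inequality that makes least squares stable needs no matrix
  concentration.  The Legendre operator L p = -((1-x^2)p')' is diagonalised by orthogonal
  polynomials with eigenvalues k(k+1), so |L p| <= n^2 |p| in L^2 for degree < n.  This gives the
  Bernstein inequality  int (1-x^2)|p'|^2 <= n^2 int |p|^2  and, since (1-t^2)p'(t) is the integral
  of L p over [t,1], the Nikolskii inequality  sup |p| <= C n |p|.

  Cut [-1,1] into about 20 n cells of arcsine length ~ 1/n and drop the two pieces of length ~ n^-2
  at the endpoints.  On a cell the oscillation of p is controlled by the Bernstein integral and on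
  the end pieces p is controlled by the Nikolskii inequality.  Hence int |p|^2 is bounded by the
  discrete norm as soon as every cell receives at least half of its expected weight.  A scalar
  Chernoff bound for each cell and a union bound show that  m ~ n^(2 beta + 2) log(3n/eps)  samples
  suffice: the weight w is unbounded when beta > 0, but only its values on the cells matter, where
  1 - x^2 >= c n^-2.

  For the noise and the residual f - f_n, Markov's inequality suffices, because w has mean 1 and
  w |f - f_n|^2 has mean |f - f_n|^2.
*)

theory Submission
  imports Defs
begin

subsection \<open>The Legendre operator and the Bernstein inequality\<close>

text \<open>Only a lower bound for the discrete norm is required: the estimator is the discrete
  orthogonal projection of the data, so the discrete norm of p - f_n is at most that of residual
  plus noise, and the lower bound carries this back to L^2. The factor n in the uniform error is the
  price of Nikolskii's inequality, and 1 / sqrt eps that of Markov's. One event must serve every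
  noise vector, so the event may refer to the noise only through the total weight of the sample. The
  exponent 2 beta + 2 comes from comparing, on the j-th of N ~ n cells, the largest weight, of order
  (j/N)^(-2 beta), with the expected weight, of order j/N^2. The ratio N^(2 beta + 2) j^(-(2 beta +
  1)) is largest at j = 1 because beta >= -1/2; for beta = -1/2 all cells are equally demanding,
  which gives n log n. The mean cost of a sample is finite once beta - alpha > -1. The conditions
  beta >= -1/2 and beta > alpha - 1 together explain the choice of beta.\<close>

definition pint :: "real poly \<Rightarrow> real" where
  "pint p = integral {-1..1} (poly p)"

lemma poly_integrable_on [simp]: "poly (p :: real poly) integrable_on {a..b}"
  by (intro integrable_continuous_real continuous_intros)

lemma pint_0 [simp]: "pint 0 = 0"
proof -
  have "poly 0 = (\<lambda>x::real. 0::real)" by (simp add: fun_eq_iff)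
  then show ?thesis by (simp add: pint_def)
qed

lemma integral_poly_add:
  "integral {a..b} (poly (p + q)) = integral {a..b} (poly p) + integral {a..b} (poly (q :: real poly))"
  unfolding poly_add by (intro Henstock_Kurzweil_Integration.integral_add) simp_all

lemma integral_poly_diff:
  "integral {a..b} (poly (p - q)) = integral {a..b} (poly p) - integral {a..b} (poly (q :: real poly))"
  unfolding poly_diff by (intro Henstock_Kurzweil_Integration.integral_diff) simp_all

lemma integral_poly_smult:
  "integral {a..b} (poly (smult c p)) = c * integral {a..b} (poly (p :: real poly))"
  unfolding poly_smult by simp

lemmas pint_add = integral_poly_add[where a = "-1" and b = 1, folded pint_def]
lemmas pint_diff = integral_poly_diff[where a = "-1" and b = 1, folded pint_def]
lemmas pint_smult = integral_poly_smult[where a = "-1" and b = 1, folded pint_def]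

lemma pint_square_nonneg: "0 \<le> pint (p * p)"
  unfolding pint_def by (intro Henstock_Kurzweil_Integration.integral_nonneg) simp_all

lemma pint_square_eq_0_iff: "pint (p * p) = 0 \<longleftrightarrow> p = 0"
proof
  assume "pint (p * p) = 0"
  then have "\<forall>x\<in>{-1..1}. poly (p * p) x = 0"
    unfolding pint_def by (subst (asm) integral_eq_0_iff) (auto intro!: continuous_intros)
  then have "{-1..1} \<subseteq> {x. poly p x = 0}" by auto
  moreover have "infinite {-1..1::real}" by (simp add: infinite_Icc)
  ultimately show "p = 0" using poly_roots_finite finite_subset by blast
qed simp

lemma integral_pderiv:
  assumes "a \<le> b" shows "integral {a..b} (poly (pderiv p)) = poly p b - poly (p :: real poly) a"
  by (rule integral_unique, rule fundamental_theorem_of_calculus[OF assms])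
    (auto simp flip: has_real_derivative_iff_has_vector_derivative
       intro!: DERIV_subset[OF poly_DERIV])

text \<open>Stated by coefficients rather than by \<open>degree\<close>: closure under linear
  combinations and under \<open>legendre_op\<close> is then checked coefficientwise, without a
  special case for the zero polynomial.\<close>

definition deg_less :: "nat \<Rightarrow> 'a::comm_ring_1 poly \<Rightarrow> bool" where
  "deg_less n p \<longleftrightarrow> (\<forall>i\<ge>n. coeff p i = 0)"

lemma deg_less_iff: "deg_less n p \<longleftrightarrow> p = 0 \<or> degree p < n"
  unfolding deg_less_def
  by (metis coeff_0 coeff_eq_0 leading_coeff_0_iff not_le_imp_less order_less_le_trans)

lemma deg_less_0 [simp]: "deg_less 0 p \<longleftrightarrow> p = 0"
  by (simp add: deg_less_iff)

lemma deg_less_diff: "deg_less n p \<Longrightarrow> deg_less n q \<Longrightarrow> deg_less n (p - q)"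
  by (simp add: deg_less_def)

lemma deg_less_add: "deg_less n p \<Longrightarrow> deg_less n q \<Longrightarrow> deg_less n (p + q)"
  by (simp add: deg_less_def)

lemma deg_less_smult: "deg_less n p \<Longrightarrow> deg_less n (smult c p)"
  by (simp add: deg_less_def)

lemma deg_less_Suc: "deg_less n p \<Longrightarrow> deg_less (Suc n) p"
  by (simp add: deg_less_def)

text \<open>The induction step on degree used throughout: subtracting a multiple of \<open>u\<close>
  removes the top coefficient and leaves a smaller case.\<close>

lemma deg_less_Suc_decompose:
  assumes "deg_less (Suc n) p" "deg_less (Suc n) u" "coeff u n = 1"
  shows "deg_less n (p - smult (coeff p n) u)"
  unfolding deg_less_def
proof (intro allI impI)
  fix i assume "n \<le> i"
  then consider "i = n" | "Suc n \<le> i" by linarith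
  then show "coeff (p - smult (coeff p n) u) i = 0"
    by cases (use assms in \<open>auto simp: deg_less_def\<close>)
qed

text \<open>Gram-Schmidt one degree at a time. \<open>y\<close> stays arbitrary in the induction
  because the hypothesis is applied to \<open>y\<close> and also to \<open>monom 1 n\<close>, whose
  residual \<open>u\<close> is the new orthogonal direction.\<close>

lemma pint_projection: "\<exists>q. deg_less n q \<and> (\<forall>r. deg_less n r \<longrightarrow> pint ((y - q) * r) = 0)"
proof (induction n arbitrary: y)
  case 0
  then show ?case by auto
next
  case (Suc n)
  obtain q0 where q0: "deg_less n q0" "\<And>r. deg_less n r \<Longrightarrow> pint ((y - q0) * r) = 0"
    using Suc.IH by blast
  obtain q1 where q1: "deg_less n q1" "\<And>r. deg_less n r \<Longrightarrow> pint ((monom 1 n - q1) * r) = 0"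
    using Suc.IH by blast
  define u where "u = monom 1 n - q1"
  have u: "deg_less (Suc n) u" "coeff u n = 1"
    using q1(1) by (auto simp: u_def deg_less_def)
  then have "u \<noteq> 0" by auto
  \<comment> \<open>The Fourier coefficient of the residual along \<open>u\<close>; the denominator
    is nonzero because \<open>u\<close> is.\<close>
  define c where "c = pint ((y - q0) * u) / pint (u * u)"
  have orth_u: "pint ((y - (q0 + smult c u)) * u) = 0"
  proof -
    have "(y - (q0 + smult c u)) * u = (y - q0) * u - smult c (u * u)"
      by (simp add: algebra_simps)
    then show ?thesis
      using \<open>u \<noteq> 0\<close> by (simp add: pint_diff pint_smult c_def pint_square_eq_0_iff)
  qed
  have "pint ((y - (q0 + smult c u)) * r) = 0" if r: "deg_less (Suc n) r" for r
  proof -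
    define s where "s = r - smult (coeff r n) u"
    have s: "deg_less n s" unfolding s_def by (rule deg_less_Suc_decompose[OF r u])
    have "(y - (q0 + smult c u)) * r =
        (y - q0) * s - smult c (u * s) + smult (coeff r n) ((y - (q0 + smult c u)) * u)"
      by (simp add: s_def algebra_simps smult_diff_right smult_add_right)
    then show ?thesis
      using q0(2)[OF s] q1(2)[OF s] orth_u by (simp add: pint_diff pint_add pint_smult u_def)
  qed
  moreover have "deg_less (Suc n) (q0 + smult c u)"
    using q0(1) u(1) by (simp add: deg_less_add deg_less_smult deg_less_Suc)
  ultimately show ?case by blast
qed

definition legendre_op :: "real poly \<Rightarrow> real poly" where
  "legendre_op p = - pderiv ([:1, 0, -1:] * pderiv p)"

lemma legendre_op_add: "legendre_op (p + q) = legendre_op p + legendre_op q"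
  by (simp only: legendre_op_def pderiv_add distrib_left minus_add_distrib)

lemma legendre_op_smult: "legendre_op (smult c p) = smult c (legendre_op p)"
  by (simp add: legendre_op_def pderiv_smult del: mult_pCons_left)

text \<open>Upper triangular in the monomial basis: the diagonal entries are the eigenvalues k(k+1),
  and since only the indices k and k + 2 occur, the degree cannot grow.\<close>

lemma coeff_legendre_op:
  "coeff (legendre_op p) k =
     real k * (real k + 1) * coeff p k - (real k + 1) * (real k + 2) * coeff p (k + 2)"
  by (cases k) (auto simp: legendre_op_def coeff_pderiv coeff_pCons algebra_simps split: nat.splits)

lemma deg_less_legendre_op: "deg_less n p \<Longrightarrow> deg_less n (legendre_op p)"
  by (simp add: deg_less_def coeff_legendre_op)

text \<open>Integration by parts. The factor 1 - x^2 vanishes at both endpoints, so no boundary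
  terms appear for any pair of polynomials.\<close>

lemma pint_legendre_op:
  "pint (legendre_op p * q) = pint ([:1, 0, -1:] * (pderiv p * pderiv q))"
proof -
  let ?r = "[:1, 0, -1:] * pderiv p * q"
  have "pint (pderiv ?r) = poly ?r 1 - poly ?r (-1)"
    unfolding pint_def by (rule integral_pderiv) simp
  also have "\<dots> = 0" by simp
  also have "pderiv ?r = [:1, 0, -1:] * (pderiv p * pderiv q) - legendre_op p * q"
    unfolding legendre_op_def pderiv_mult[of "[:1, 0, -1:] * pderiv p" q] by (simp only: algebra_simps)
  finally show ?thesis by (simp add: pint_diff del: mult_pCons_left)
qed

lemma legendre_op_symmetric: "pint (legendre_op p * q) = pint (p * legendre_op q)"
  using pint_legendre_op[of p q] pint_legendre_op[of q p] by (simp add: mult.commute)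

text \<open>\<open>u\<close> is the monic Legendre polynomial. The defect \<open>s\<close> of the
  eigenvalue equation loses its leading term, so it has degree below \<open>n\<close>; symmetry
  moves the operator from \<open>u\<close> onto \<open>s\<close>, and orthogonality of
  \<open>u\<close> to lower degrees makes \<open>s\<close> orthogonal to itself.\<close>

lemma legendre_eigenpoly:
  obtains u where "deg_less (Suc n) u" "coeff u n = 1"
    "\<And>r. deg_less n r \<Longrightarrow> pint (u * r) = 0"
    "legendre_op u = smult (real n * (real n + 1)) u"
proof -
  obtain q1 where q1: "deg_less n q1" "\<And>r. deg_less n r \<Longrightarrow> pint ((monom 1 n - q1) * r) = 0"
    using pint_projection by blast
  define u where "u = monom 1 n - q1"
  have u: "deg_less (Suc n) u" "coeff u n = 1"
    using q1(1) by (auto simp: u_def deg_less_def)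
  have orth: "pint (u * r) = 0" if "deg_less n r" for r
    using q1(2)[OF that] by (simp add: u_def)
  define s where "s = legendre_op u - smult (real n * (real n + 1)) u"
  have "coeff (legendre_op u) n = real n * (real n + 1)"
    using u by (simp add: coeff_legendre_op deg_less_def)
  then have s: "deg_less n s"
    using deg_less_Suc_decompose[OF deg_less_legendre_op[OF u(1)] u] by (simp add: s_def)
  have "pint (s * s) = pint (legendre_op u * s) - real n * (real n + 1) * pint (u * s)"
    by (simp add: s_def left_diff_distrib pint_diff flip: pint_smult)
  also have "\<dots> = 0"
    using orth[OF deg_less_legendre_op[OF s]] orth[OF s] by (simp add: legendre_op_symmetric)
  finally have "s = 0" by (simp add: pint_square_eq_0_iff)
  then show thesis using that u orth by (simp add: s_def)
qed

text \<open>Each step splits off the eigenpolynomial of top degree. It is orthogonal to the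
  remainder and to the image of the remainder, so squared norms add on both sides.\<close>

lemma pint_legendre_op_square_le:
  assumes "deg_less n p"
  shows "pint (legendre_op p * legendre_op p) \<le> real n ^ 4 * pint (p * p)"
  using assms
proof (induction n arbitrary: p)
  case 0
  then show ?case by (simp add: legendre_op_def)
next
  case (Suc n)
  obtain u where u: "deg_less (Suc n) u" "coeff u n = 1"
    and orth: "\<And>r. deg_less n r \<Longrightarrow> pint (u * r) = 0"
    and ev: "legendre_op u = smult (real n * (real n + 1)) u"
    using legendre_eigenpoly by metis
  define c where "c = coeff p n"
  define q where "q = p - smult c u"
  have q: "deg_less n q" unfolding q_def c_def by (rule deg_less_Suc_decompose[OF Suc.prems u])
  define l where "l = real n * (real n + 1)"
  have p: "p = q + smult c u" by (simp add: q_def)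
  have Lp: "legendre_op p = legendre_op q + smult (c * l) u"
    by (simp add: p legendre_op_add legendre_op_smult ev l_def)
  have expand: "pint ((r + smult d u) * (r + smult d u)) = pint (r * r) + d\<^sup>2 * pint (u * u)"
    if "deg_less n r" for r d
  proof -
    have "(r + smult d u) * (r + smult d u) =
        r * r + smult d (u * r) + smult d (u * r) + smult (d\<^sup>2) (u * u)"
      by (simp add: distrib_left distrib_right smult_add_right power2_eq_square mult.commute)
    then have "pint ((r + smult d u) * (r + smult d u)) =
        pint (r * r) + d * pint (u * r) + d * pint (u * r) + d\<^sup>2 * pint (u * u)"
      by (simp only: pint_add pint_smult)
    then show ?thesis using orth[OF that] by simp
  qed
  \<comment> \<open>The induction is at \<open>Suc n\<close>, so the top degree is \<open>n\<close>
    and its eigenvalue n(n+1) stays below (n+1)^2.\<close>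
  have "l \<le> (real (Suc n))\<^sup>2" by (simp add: l_def power2_eq_square algebra_simps)
  then have l: "l\<^sup>2 \<le> real (Suc n) ^ 4"
    using power_mono[of l "(real (Suc n))\<^sup>2" 2] by (simp add: l_def)
  have "pint (legendre_op p * legendre_op p) =
      pint (legendre_op q * legendre_op q) + (c * l)\<^sup>2 * pint (u * u)"
    unfolding Lp by (rule expand[OF deg_less_legendre_op[OF q]])
  also have "\<dots> \<le> real n ^ 4 * pint (q * q) + (c\<^sup>2 * pint (u * u)) * l\<^sup>2"
    using Suc.IH[OF q] by (simp add: power_mult_distrib mult_ac)
  also have "\<dots> \<le> real (Suc n) ^ 4 * pint (q * q) + (c\<^sup>2 * pint (u * u)) * real (Suc n) ^ 4"
    using l by (intro add_mono mult_right_mono mult_left_mono power_mono mult_nonneg_nonneg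
        pint_square_nonneg) auto
  also have "\<dots> = real (Suc n) ^ 4 * pint (p * p)"
    using expand[OF q, of c] by (simp add: p algebra_simps)
  finally show ?case .
qed

lemma pint_mono:
  assumes "\<And>x. x \<in> {-1..1} \<Longrightarrow> poly p x \<le> poly q x" shows "pint p \<le> pint q"
  unfolding pint_def using assms by (intro integral_le) auto

text \<open>The left side is the pairing of \<open>legendre_op p\<close> with \<open>p\<close>. The
  inequality a b <= a^2 / (2N) + N b^2 / 2 with N = n^2 balances the two terms: each contributes
  half of the bound.\<close>

lemma pint_bernstein:
  assumes "deg_less n p"
  shows "pint ([:1, 0, -1:] * (pderiv p * pderiv p)) \<le> (real n)\<^sup>2 * pint (p * p)"
proof (cases "n = 0")
  case True
  then show ?thesis using assms by simp
next
  case False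
  let ?L = "legendre_op p"
  let ?q = "smult (1 / (2 * (real n)\<^sup>2)) (?L * ?L) + smult ((real n)\<^sup>2 / 2) (p * p)"
  have "poly (?L * p) x \<le> poly ?q x" for x
  proof -
    define a b N where "a = poly ?L x" and "b = poly p x" and "N = (real n)\<^sup>2"
    have "N > 0" using False by (simp add: N_def)
    have "0 \<le> (a - N * b)\<^sup>2 / (2 * N)" using \<open>N > 0\<close> by simp
    also have "\<dots> = a * a / (2 * N) + N / 2 * (b * b) - a * b"
      using \<open>N > 0\<close> by (simp add: power2_eq_square field_simps)
    finally show ?thesis by (simp add: a_def b_def N_def)
  qed
  then have "pint (?L * p) \<le> pint ?q" by (rule pint_mono)
  also have "\<dots> = pint (?L * ?L) / (2 * (real n)\<^sup>2) + (real n)\<^sup>2 / 2 * pint (p * p)"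
    by (simp add: pint_add pint_smult)
  also have "\<dots> \<le> real n ^ 4 * pint (p * p) / (2 * (real n)\<^sup>2) + (real n)\<^sup>2 / 2 * pint (p * p)"
    using pint_legendre_op_square_le[OF assms] by (simp add: divide_right_mono)
  also have "\<dots> = (real n)\<^sup>2 * pint (p * p)"
    using False by (simp add: power4_eq_xxxx power2_eq_square field_simps)
  finally show ?thesis by (simp only: pint_legendre_op)
qed

subsection \<open>The Nikolskii inequality\<close>

lemma integral_square_le_pint:
  assumes "-1 \<le> a" "b \<le> 1"
  shows "integral {a..b} (poly (p * p)) \<le> pint (p * p)"
  unfolding pint_def using assms by (intro integral_subset_le) auto

lemma integral_poly_const:
  assumes "a \<le> b" shows "integral {a..b} (poly [:c:]) = (b - a) * (c::real)"
proof -
  have "poly [:c:] = (\<lambda>_. c)" by (simp add: fun_eq_iff)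
  then show ?thesis using assms by simp
qed

text \<open>Cauchy-Schwarz against the constant 1, read off from the nonnegative integral of (p -
  c)^2 with \<open>c\<close> the mean of \<open>p\<close> on the interval.\<close>

lemma integral_poly_power2_le:
  fixes p :: "real poly"
  assumes "a \<le> b"
  shows "(integral {a..b} (poly p))\<^sup>2 \<le> (b - a) * integral {a..b} (poly (p * p))"
proof (cases "a = b")
  case False
  define I c where "I = integral {a..b} (poly p)" and "c = I / (b - a)"
  have "0 \<le> integral {a..b} (poly ((p - [:c:]) * (p - [:c:])))"
    by (intro Henstock_Kurzweil_Integration.integral_nonneg) (auto simp flip: power2_eq_square)
  also have "(p - [:c:]) * (p - [:c:]) = p * p - smult (2 * c) p + [:c\<^sup>2:]"
    by (simp add: algebra_simps power2_eq_square flip: smult_add_left)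
  also have "integral {a..b} (poly \<dots>) =
      integral {a..b} (poly (p * p)) - 2 * c * I + c\<^sup>2 * (b - a)"
    using assms
    by (simp add: integral_poly_add integral_poly_diff integral_poly_smult integral_poly_const I_def)
  also have "\<dots> = integral {a..b} (poly (p * p)) - I\<^sup>2 / (b - a)"
  proof -
    have "c * (b - a) = I" using False by (simp add: c_def)
    then have "c\<^sup>2 * (b - a) = c * I" by (simp add: power2_eq_square mult.assoc)
    moreover have "I\<^sup>2 / (b - a) = c * I" by (simp add: c_def power2_eq_square)
    ultimately show ?thesis by simp
  qed
  finally show ?thesis
    using False assms by (simp add: I_def pos_divide_le_eq mult.commute)
qed simp

text \<open>Cauchy-Schwarz on [t, 1] gives (1 - t^2)^2 p'(t)^2 <= (1 - t) n^4 |p|^2. As t >= 0, the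
  factor 1 - t^2 may be replaced by 1 - t, which leaves the singularity (1 - t)^(-1/2), integrable
  up to the endpoint.\<close>

lemma pderiv_bound:
  assumes p: "deg_less n p" and t: "0 \<le> t" "t < 1"
  shows "\<bar>poly (pderiv p) t\<bar> \<le> (real n)\<^sup>2 * sqrt (pint (p * p)) / sqrt (1 - t)"
proof -
  define d where "d = poly (pderiv p) t"
  define Q where "Q = pint (p * p)"
  define r where "r = [:1, 0, -1:] * pderiv p"
  have L: "legendre_op p * legendre_op p = pderiv r * pderiv r"
    by (simp add: legendre_op_def r_def del: mult_pCons_left)
  have "(1 - t)\<^sup>2 * d\<^sup>2 \<le> ((1 - t\<^sup>2) * d)\<^sup>2"
  proof -
    have "1 - t \<le> 1 - t\<^sup>2" using t by (simp add: power2_eq_square mult_left_le)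
    then have "(1 - t)\<^sup>2 \<le> (1 - t\<^sup>2)\<^sup>2" using t by (intro power_mono) auto
    then show ?thesis by (simp add: power_mult_distrib mult_right_mono)
  qed
  also have "\<dots> = (integral {t..1} (poly (pderiv r)))\<^sup>2"
    using t by (subst integral_pderiv) (auto simp: r_def d_def power2_eq_square algebra_simps)
  also have "\<dots> \<le> (1 - t) * integral {t..1} (poly (pderiv r * pderiv r))"
    using t by (intro integral_poly_power2_le) auto
  also have "\<dots> \<le> (1 - t) * pint (legendre_op p * legendre_op p)"
    unfolding L using t by (intro mult_left_mono integral_square_le_pint) auto
  also have "\<dots> \<le> (1 - t) * (real n ^ 4 * Q)"
    unfolding Q_def using t by (intro mult_left_mono pint_legendre_op_square_le p) auto
  finally have "(1 - t) * ((1 - t) * d\<^sup>2) \<le> (1 - t) * (real n ^ 4 * Q)"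
    by (simp add: power2_eq_square mult.assoc)
  then have *: "(1 - t) * d\<^sup>2 \<le> real n ^ 4 * Q"
    using t by (simp add: mult_le_cancel_left)
  have "sqrt ((1 - t) * d\<^sup>2) \<le> sqrt (real n ^ 4 * Q)" using * by simp
  moreover have "sqrt (real n ^ 4) = (real n)\<^sup>2"
    by (rule real_sqrt_unique) (auto simp: power2_eq_square power4_eq_xxxx)
  ultimately have "sqrt (1 - t) * \<bar>d\<bar> \<le> (real n)\<^sup>2 * sqrt Q"
    by (simp add: real_sqrt_mult)
  then show ?thesis using t by (simp add: d_def Q_def field_simps)
qed

lemma poly_increment_le:
  assumes p: "deg_less n p" and xy: "0 \<le> x" "x \<le> y" "y \<le> 1"
  shows "poly p y - poly p x \<le> 2 * (real n)\<^sup>2 * sqrt (pint (p * p)) * sqrt (y - x)"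
proof (cases "x = y")
  case False
  define K where "K = (real n)\<^sup>2 * sqrt (pint (p * p))"
  have "K \<ge> 0" by (simp add: K_def pint_square_nonneg)
  \<comment> \<open>The added term has derivative - K / sqrt (1 - t), which compensates
    \<open>pderiv_bound\<close> and makes \<open>g\<close> decreasing. Differentiability is needed
    only in the open interval, so y = 1 is allowed and no improper integral arises.\<close>
  define g where "g = (\<lambda>t. poly p t + 2 * K * sqrt (1 - t))"
  have "g x \<ge> g y"
  proof (rule DERIV_nonpos_imp_decreasing_open[where f = g and a = x and b = y])
    show "x \<le> y" by fact
    show "continuous_on {x..y} g" unfolding g_def by (intro continuous_intros)
    fix t assume t: "x < t" "t < y"
    have "(g has_real_derivative poly (pderiv p) t - K / sqrt (1 - t)) (at t)"
      unfolding g_def using t xy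
      by (auto intro!: derivative_eq_intros poly_DERIV simp: field_simps)
    moreover have "poly (pderiv p) t - K / sqrt (1 - t) \<le> 0"
      using pderiv_bound[OF p, of t] t xy unfolding K_def by auto
    ultimately show "\<exists>d. (g has_real_derivative d) (at t) \<and> d \<le> 0" by blast
  qed
  then have "poly p y - poly p x \<le> 2 * K * (sqrt (1 - x) - sqrt (1 - y))"
    by (simp add: g_def algebra_simps)
  also have "sqrt (1 - x) \<le> sqrt (1 - y) + sqrt (y - x)"
    using sqrt_add_le_add_sqrt[of "1 - y" "y - x"] xy by simp
  then have "2 * K * (sqrt (1 - x) - sqrt (1 - y)) \<le> 2 * K * sqrt (y - x)"
    using \<open>K \<ge> 0\<close> by (intro mult_left_mono) auto
  finally show ?thesis by (simp add: K_def mult.assoc)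
qed simp

lemma poly_oscillation_le:
  assumes p: "deg_less n p" and xy: "x \<in> {0..1}" "y \<in> {0..1}"
  shows "\<bar>poly p y - poly p x\<bar> \<le> 2 * (real n)\<^sup>2 * sqrt (pint (p * p)) * sqrt \<bar>y - x\<bar>"
proof -
  have m: "deg_less n (-p)" using p by (simp add: deg_less_def)
  show ?thesis
    using poly_increment_le[OF p, of x y] poly_increment_le[OF p, of y x]
      poly_increment_le[OF m, of x y] poly_increment_le[OF m, of y x] xy
    by (cases "x \<le> y") auto
qed

text \<open>Transfers estimates proved on [0, 1] to [-1, 0], so that only the endpoint 1 has to be
  treated.\<close>

definition reflect :: "real poly \<Rightarrow> real poly" where
  "reflect p = pcompose p [:0, -1:]"

lemma poly_reflect [simp]: "poly (reflect p) x = poly p (-x)"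
  by (simp add: reflect_def poly_pcompose)

lemma deg_less_reflect: "deg_less n p \<Longrightarrow> deg_less n (reflect p)"
  by (auto simp: deg_less_iff reflect_def degree_pcompose)

lemma integral_reflect: "integral {-b..-a} (poly (reflect p)) = integral {a..b} (poly p)"
proof -
  have "poly (reflect p) = (\<lambda>x. poly p (- x))" by (simp add: fun_eq_iff)
  then show ?thesis by (simp only: Henstock_Kurzweil_Integration.integral_reflect_real)
qed

lemma reflect_mult: "reflect (p * q) = reflect p * reflect q"
  by (simp add: reflect_def pcompose_mult)

lemma pint_reflect: "pint (reflect p) = pint p"
  using integral_reflect[of 1 "-1" p] by (simp add: pint_def)

lemma square_le_double: "(a::real)\<^sup>2 \<le> 2 * b\<^sup>2 + 2 * (a - b)\<^sup>2"
  using zero_le_power2[of "a - 2 * b"] by (simp add: power2_eq_square algebra_simps)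

text \<open>Averaging over a window of length n^(-2) containing x: by
  \<open>poly_oscillation_le\<close>, \<open>p\<close> changes there by at most 2 n |p|, the order
  of the claimed bound, while the mean of p^2 over the window is at most n^2 |p|^2.\<close>

lemma nikolskii_nonneg:
  assumes p: "deg_less n p" and x: "x \<in> {0..1}"
  shows "(poly p x)\<^sup>2 \<le> 10 * (real n)\<^sup>2 * pint (p * p)"
proof (cases "n = 0")
  case True
  then show ?thesis using p by simp
next
  case False
  \<comment> \<open>Near 1 the window is shifted to the left, so that it contains x and stays inside
    [0, 1].\<close>
  define Q h a where "Q = pint (p * p)" and "h = 1 / (real n)\<^sup>2" and "a = min x (1 - h)"
  have "Q \<ge> 0" by (simp add: Q_def pint_square_nonneg)
  have h: "h > 0" "h \<le> 1" "h * (real n)\<^sup>2 = 1" using False by (auto simp: h_def)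
  have a: "0 \<le> a" "a + h \<le> 1" "a \<le> x" "x \<le> a + h" using h x by (auto simp: a_def)
  have "(poly p x)\<^sup>2 \<le> 2 * (poly p y)\<^sup>2 + 8 * (real n)\<^sup>2 * Q" if y: "y \<in> {a..a + h}" for y
  proof -
    have "\<bar>poly p x - poly p y\<bar> \<le> 2 * (real n)\<^sup>2 * sqrt Q * sqrt \<bar>x - y\<bar>"
      unfolding Q_def by (rule poly_oscillation_le[OF p]) (use a y in auto)
    also have "\<dots> \<le> 2 * (real n)\<^sup>2 * sqrt Q * sqrt h"
      using a y \<open>Q \<ge> 0\<close> by (intro mult_left_mono real_sqrt_le_mono) auto
    finally have "(poly p x - poly p y)\<^sup>2 \<le> (2 * (real n)\<^sup>2 * sqrt Q * sqrt h)\<^sup>2"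
      by (rule abs_le_square_iff[THEN iffD1, OF order_trans]) (use \<open>Q \<ge> 0\<close> h in auto)
    also have "\<dots> = 4 * (real n)\<^sup>2 * Q * (h * (real n)\<^sup>2)"
      using \<open>Q \<ge> 0\<close> h(1) by (simp add: power_mult_distrib)
    also have "\<dots> = 4 * (real n)\<^sup>2 * Q" using h by simp
    finally show ?thesis using square_le_double[of "poly p x" "poly p y"] by linarith
  qed
  then have "integral {a..a + h} (\<lambda>_. (poly p x)\<^sup>2)
      \<le> integral {a..a + h} (poly (smult 2 (p * p) + [:8 * (real n)\<^sup>2 * Q:]))"
    by (intro integral_le) (auto simp: power2_eq_square algebra_simps)
  also have "\<dots> = 2 * integral {a..a + h} (poly (p * p)) + h * (8 * (real n)\<^sup>2 * Q)"
    unfolding integral_poly_add integral_poly_smult using h by (simp add: integral_poly_const)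
  also have "h * (8 * (real n)\<^sup>2 * Q) = 8 * Q * (h * (real n)\<^sup>2)"
    by (simp only: mult_ac)
  also have "integral {a..a + h} (poly (p * p)) \<le> Q"
    unfolding Q_def using a by (intro integral_square_le_pint) auto
  finally have "h * (poly p x)\<^sup>2 \<le> 10 * Q" using h by simp
  then show ?thesis using False by (simp add: h_def Q_def field_simps)
qed

lemma nikolskii:
  assumes p: "deg_less n p" and x: "x \<in> {-1..1}"
  shows "(poly p x)\<^sup>2 \<le> 10 * (real n)\<^sup>2 * pint (p * p)"
proof (cases "x \<ge> 0")
  case True
  then show ?thesis using nikolskii_nonneg[OF p, of x] x by simp
next
  case False
  then show ?thesis
    using nikolskii_nonneg[OF deg_less_reflect[OF p], of "-x"] x
    by (simp add: pint_reflect flip: reflect_mult)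
qed

subsection \<open>The discrete norm inequality\<close>

text \<open>The quadratic spacing makes the cells about equally long in arcsine measure on \<open>(0, 1)\<close>;
  the cells of the negative half are their mirror images.\<close>

definition node :: "nat \<Rightarrow> nat \<Rightarrow> real" where
  "node N j = 1 - (real j / real N)\<^sup>2"

text \<open>Nodes decrease in \<open>j\<close>, and \<open>cell N 0\<close> is the piece at the
  endpoint; this is why indices start at 1 below. Half-open intervals keep the cells
  disjoint.\<close>

definition cell :: "nat \<Rightarrow> nat \<Rightarrow> real set" where
  "cell N j = {node N (Suc j)<..node N j}"

lemma node_antimono: "i \<le> j \<Longrightarrow> node N j \<le> node N i"
  by (auto simp: node_def intro!: power_mono divide_right_mono)

lemma node_diff: "node N j - node N (Suc j) = (2 * real j + 1) / (real N)\<^sup>2"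
  by (cases "N = 0") (auto simp: node_def power2_eq_square field_simps)

lemma node_nonneg: "j \<le> N \<Longrightarrow> 0 \<le> node N j"
  by (cases "N = 0") (auto simp: node_def power_le_one)

lemma node_0 [simp]: "node N 0 = 1"
  by (simp add: node_def)

lemma node_self [simp]: "N > 0 \<Longrightarrow> node N N = 0"
  by (simp add: node_def)

lemma cell_disjoint: "disjoint_family (cell N)"
proof -
  have "cell N i \<inter> cell N j = {}" if "i < j" for i j
    using node_antimono[of "Suc i" j N] that by (auto simp: cell_def)
  then show ?thesis
    unfolding disjoint_family_on_def by (metis Int_commute linorder_neqE_nat)
qed

text \<open>The reason for the quadratic spacing: on the cell 1 - t^2 >= (j/N)^2, while its length
  is (2j+1)/N^2 <= 3j/N^2 as j >= 1. Hence length^2 / (1 - t^2) <= 9/N^2 for every \<open>j\<close>,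
  and the Bernstein integral controls the oscillation uniformly over the cells.\<close>

lemma integral_cell_le:
  assumes j: "1 \<le> j" "j < N" and y: "y \<in> cell N j"
  defines "I \<equiv> {node N (Suc j)..node N j}"
  shows "integral I (poly (p * p)) \<le> 2 * (node N j - node N (Suc j)) * (poly p y)\<^sup>2 +
    18 / (real N)\<^sup>2 * integral I (poly ([:1, 0, -1:] * (pderiv p * pderiv p)))"
proof -
  define l where "l = node N j - node N (Suc j)"
  define k where "k = (real j / real N)\<^sup>2"
  define F where "F = integral I (poly (pderiv p * pderiv p))"
  define E where "E = integral I (poly ([:1, 0, -1:] * (pderiv p * pderiv p)))"
  have l: "l \<ge> 0" using node_antimono[of j "Suc j" N] by (simp add: l_def)
  have k: "k > 0" using j by (simp add: k_def)
  have y: "y \<in> I" using y by (auto simp: I_def cell_def)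
  have "k * F = integral I (poly (smult k (pderiv p * pderiv p)))"
    by (simp only: F_def I_def integral_poly_smult)
  also have "\<dots> \<le> E"
    unfolding E_def I_def
  proof (intro integral_le)
    fix t assume t: "t \<in> {node N (Suc j)..node N j}"
    have "0 \<le> t" using t node_nonneg[of "Suc j" N] j by auto
    have "k \<le> 1 - t" using t by (auto simp: node_def k_def)
    moreover have "t * t \<le> t" using \<open>0 \<le> t\<close> \<open>k \<le> 1 - t\<close> k by (intro mult_left_le) auto
    ultimately have "k \<le> 1 - t * t" by linarith
    then have "k * (poly (pderiv p) t)\<^sup>2 \<le> (1 - t * t) * (poly (pderiv p) t)\<^sup>2"
      by (rule mult_right_mono) simp
    then show "poly (smult k (pderiv p * pderiv p)) t
        \<le> poly ([:1, 0, -1:] * (pderiv p * pderiv p)) t"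
      by (simp add: power2_eq_square algebra_simps)
  qed simp_all
  finally have F: "F \<le> E / k" using k by (simp add: field_simps)
  have inc: "(poly p b - poly p a)\<^sup>2 \<le> l * F" if "a \<in> I" "b \<in> I" "a \<le> b" for a b
  proof -
    have "(poly p b - poly p a)\<^sup>2 = (integral {a..b} (poly (pderiv p)))\<^sup>2"
      using that by (simp add: integral_pderiv)
    also have "\<dots> \<le> (b - a) * integral {a..b} (poly (pderiv p * pderiv p))"
      using that by (intro integral_poly_power2_le) auto
    also have "\<dots> \<le> l * F"
      using that l unfolding F_def
      by (intro mult_mono integral_subset_le Henstock_Kurzweil_Integration.integral_nonneg)
         (auto simp: I_def l_def)
    finally show ?thesis .
  qed
  have "(poly p x)\<^sup>2 \<le> 2 * (poly p y)\<^sup>2 + 2 * (l * (E / k))" if x: "x \<in> I" for x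
  proof -
    have "(poly p x - poly p y)\<^sup>2 \<le> l * F"
      using inc[OF x y] inc[OF y x] by (cases "x \<le> y") (auto simp: power2_commute)
    also have "\<dots> \<le> l * (E / k)" using F l by (rule mult_left_mono)
    finally show ?thesis using square_le_double[of "poly p x" "poly p y"] by linarith
  qed
  then have "integral I (poly (p * p)) \<le> integral I (\<lambda>_. 2 * (poly p y)\<^sup>2 + 2 * (l * (E / k)))"
    unfolding I_def by (intro integral_le) (auto simp: power2_eq_square)
  also have "\<dots> = 2 * l * (poly p y)\<^sup>2 + 2 * (l\<^sup>2 / k) * E"
  proof -
    have "integral I (\<lambda>_. c) = l * c" for c
      using l by (simp add: I_def l_def)
    then show ?thesis by (simp add: power2_eq_square algebra_simps)
  qed
  also have "2 * (l\<^sup>2 / k) * E \<le> 18 / (real N)\<^sup>2 * E"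
  proof (rule mult_right_mono)
    have "(2 * real j + 1)\<^sup>2 \<le> (3 * real j)\<^sup>2" using j by (intro power_mono) auto
    then have "(2 * real j + 1)\<^sup>2 / (real j)\<^sup>2 \<le> 9" using j by (simp add: field_simps)
    moreover have "l\<^sup>2 / k = (2 * real j + 1)\<^sup>2 / (real j)\<^sup>2 / (real N)\<^sup>2"
      using j by (simp add: l_def node_diff k_def power2_eq_square field_simps)
    ultimately have "l\<^sup>2 / k \<le> 9 / (real N)\<^sup>2" by (simp only: divide_right_mono zero_le_power2)
    then show "2 * (l\<^sup>2 / k) \<le> 18 / (real N)\<^sup>2" by simp
    have "F \<ge> 0" unfolding F_def I_def
      by (intro Henstock_Kurzweil_Integration.integral_nonneg) auto
    then have "E / k \<ge> 0" using F by linarith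
    then show "0 \<le> E" using k by (simp add: zero_le_divide_iff)
  qed
  finally show ?thesis by (simp add: l_def E_def)
qed

lemma sum_integral_nodes:
  assumes "1 \<le> M"
  shows "(\<Sum>j=1..<M. integral {node N (Suc j)..node N j} (poly q)) =
    integral {node N M..node N 1} (poly (q :: real poly))"
  using assms
proof (induction M rule: dec_induct)
  case (step M)
  have "integral {node N (Suc M)..node N M} (poly q) + integral {node N M..node N 1} (poly q) =
      integral {node N (Suc M)..node N 1} (poly q)"
    using step.hyps by (intro Henstock_Kurzweil_Integration.integral_combine node_antimono) auto
  then show ?case using step by simp
qed simp

lemma integral_weighted_mono:
  assumes "-1 \<le> a" "a \<le> b" "b \<le> c" "c \<le> 1"
  shows "integral {a..b} (poly ([:1, 0, -1:] * (q * q))) \<le>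
    integral {a..c} (poly ([:1, 0, -1:] * (q * q :: real poly)))"
proof (intro integral_subset_le ballI)
  fix t assume t: "t \<in> {a..c}"
  then have "t\<^sup>2 \<le> 1" using assms by (auto simp: abs_square_le_1)
  then have "0 \<le> (1 - t\<^sup>2) * (poly q t)\<^sup>2" by simp
  then show "0 \<le> poly ([:1, 0, -1:] * (q * q)) t"
    by (simp add: power2_eq_square algebra_simps)
qed (use assms in auto)

text \<open>\<open>integral_cell_le\<close> is multiplied by the weight of each sample in the cell
  and summed, so only the total weight in a cell matters, not the positions. The factor 4 encodes
  half of the expected weight, since a cell has \<open>rho\<close>-mass equal to half its
  length.\<close>

lemma frame_nonneg:
  fixes u x :: "nat \<Rightarrow> real"
  assumes N: "N > 0" and u: "\<And>i. i < m \<Longrightarrow> 0 \<le> u i"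
    and cells: "\<And>j. j \<in> {1..<N} \<Longrightarrow>
      node N j - node N (Suc j) \<le> 4 * (\<Sum>i<m. u i * indicator (cell N j) (x i))"
  shows "integral {0..node N 1} (poly (p * p)) \<le>
    8 * (\<Sum>i<m. u i * (poly p (x i))\<^sup>2 * indicator {0<..} (x i)) +
    18 / (real N)\<^sup>2 * integral {0..1} (poly ([:1, 0, -1:] * (pderiv p * pderiv p)))"
proof -
  define l where "l j = node N j - node N (Suc j)" for j
  define R where "R j = integral {node N (Suc j)..node N j} (poly (p * p))" for j
  define E where
    "E j = integral {node N (Suc j)..node N j} (poly ([:1, 0, -1:] * (pderiv p * pderiv p)))" for j
  define S where "S j = (\<Sum>i<m. u i * (poly p (x i))\<^sup>2 * indicator (cell N j) (x i))" for j
  have cell: "R j \<le> 8 * S j + 18 / (real N)\<^sup>2 * E j" if j: "j \<in> {1..<N}" for j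
  proof -
    define U where "U = (\<Sum>i<m. u i * indicator (cell N j) (x i))"
    have l: "0 < l j" "l j \<le> 4 * U"
      using N cells[OF j] by (auto simp: l_def node_diff U_def)
    have "U * (R j - 18 / (real N)\<^sup>2 * E j) =
        (\<Sum>i<m. u i * indicator (cell N j) (x i) * (R j - 18 / (real N)\<^sup>2 * E j))"
      unfolding U_def by (rule sum_distrib_right)
    also have "\<dots> \<le> (\<Sum>i<m. 2 * l j * (u i * (poly p (x i))\<^sup>2 * indicator (cell N j) (x i)))"
    proof (rule sum_mono)
      fix i assume i: "i \<in> {..<m}"
      show "u i * indicator (cell N j) (x i) * (R j - 18 / (real N)\<^sup>2 * E j) \<le>
          2 * l j * (u i * (poly p (x i))\<^sup>2 * indicator (cell N j) (x i))"
      proof (cases "x i \<in> cell N j")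
        case True
        then have "R j - 18 / (real N)\<^sup>2 * E j \<le> 2 * l j * (poly p (x i))\<^sup>2"
          using integral_cell_le[of j N "x i" p] j by (simp add: l_def R_def E_def)
        then have "u i * (R j - 18 / (real N)\<^sup>2 * E j) \<le> u i * (2 * l j * (poly p (x i))\<^sup>2)"
          using u i by (intro mult_left_mono) auto
        then show ?thesis using True by (simp add: mult_ac)
      qed simp
    qed
    also have "\<dots> = 2 * l j * S j" unfolding S_def by (rule sum_distrib_left[symmetric])
    \<comment> \<open>Replacing the length by 4 U makes both sides multiples of the positive number
      \<open>U\<close>, which then cancels.\<close>
    also have "\<dots> \<le> 2 * (4 * U) * S j"
      using l u by (intro mult_right_mono) (auto simp: S_def intro!: sum_nonneg)
    finally have "U * (R j - 18 / (real N)\<^sup>2 * E j) \<le> U * (8 * S j)" by (simp add: mult_ac)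
    then show ?thesis using l by (simp add: mult_le_cancel_left)
  qed
  have "integral {0..node N 1} (poly (p * p)) = (\<Sum>j=1..<N. R j)"
    using N sum_integral_nodes[of N N "p * p"] by (simp add: R_def)
  also have "\<dots> \<le> (\<Sum>j=1..<N. 8 * S j + 18 / (real N)\<^sup>2 * E j)"
    by (rule sum_mono) (rule cell)
  also have "\<dots> = 8 * (\<Sum>j=1..<N. S j) + 18 / (real N)\<^sup>2 * (\<Sum>j=1..<N. E j)"
    by (simp add: sum.distrib sum_distrib_left)
  finally have sums: "integral {0..node N 1} (poly (p * p)) \<le>
      8 * (\<Sum>j=1..<N. S j) + 18 / (real N)\<^sup>2 * (\<Sum>j=1..<N. E j)" .
  \<comment> \<open>The half-line indicator is kept so that positive samples and mirrored negative
    ones can later be added without counting any sample twice.\<close>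
  have S: "(\<Sum>j=1..<N. S j) \<le> (\<Sum>i<m. u i * (poly p (x i))\<^sup>2 * indicator {0<..} (x i))"
  proof -
    have ind: "(\<Sum>j=1..<N. indicator (cell N j) t) \<le> (indicator {0<..} t :: real)" for t
    proof -
      have "(\<Sum>j=1..<N. indicator (cell N j) t :: real) = indicator (\<Union>j\<in>{1..<N}. cell N j) t"
        by (rule indicator_UN_disjoint[symmetric])
          (use cell_disjoint in \<open>auto simp: disjoint_family_on_def\<close>)
      also have "\<dots> \<le> indicator {0<..} t"
      proof -
        have "0 < s" if "s \<in> cell N j" "j < N" for s j
          using node_nonneg[of "Suc j" N] that by (auto simp: cell_def)
        then show ?thesis by (auto simp: indicator_def)
      qed
      finally show ?thesis .
    qed
    have "(\<Sum>j=1..<N. S j) =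
        (\<Sum>i<m. u i * (poly p (x i))\<^sup>2 * (\<Sum>j=1..<N. indicator (cell N j) (x i)))"
      unfolding S_def by (subst sum.swap) (simp add: sum_distrib_left)
    also have "\<dots> \<le> (\<Sum>i<m. u i * (poly p (x i))\<^sup>2 * indicator {0<..} (x i))"
      using u ind by (intro sum_mono mult_left_mono) auto
    finally show ?thesis .
  qed
  have "(\<Sum>j=1..<N. E j) = integral {0..node N 1} (poly ([:1, 0, -1:] * (pderiv p * pderiv p)))"
    unfolding E_def by (subst sum_integral_nodes) (use N in auto)
  also have "\<dots> \<le> integral {0..1} (poly ([:1, 0, -1:] * (pderiv p * pderiv p)))"
    using N by (intro integral_weighted_mono node_nonneg)
      (auto simp: node_def)
  finally have E: "(\<Sum>j=1..<N. E j) \<le>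
      integral {0..1} (poly ([:1, 0, -1:] * (pderiv p * pderiv p)))" .
  show ?thesis
    by (rule order_trans[OF sums add_mono[OF mult_left_mono[OF S] mult_left_mono[OF E]]]) auto
qed

lemma pint_split: "pint q = integral {-1..0} (poly q) + integral {0..1} (poly q)"
  unfolding pint_def by (subst Henstock_Kurzweil_Integration.integral_combine) auto

lemma tail_le:
  assumes p: "deg_less n p" and N: "N > 0"
  shows "integral {0..1} (poly (p * p)) \<le>
    integral {0..node N 1} (poly (p * p)) + 10 * (real n)\<^sup>2 / (real N)\<^sup>2 * pint (p * p)"
proof -
  have n1: "0 \<le> node N 1" "node N 1 \<le> 1" using N node_nonneg[of 1 N] by (auto simp: node_def)
  have "integral {node N 1..1} (poly (p * p)) \<le>
      integral {node N 1..1} (\<lambda>_. 10 * (real n)\<^sup>2 * pint (p * p))"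
    using nikolskii[OF p] n1 by (intro integral_le) (auto simp flip: power2_eq_square)
  also have "\<dots> = 10 * (real n)\<^sup>2 / (real N)\<^sup>2 * pint (p * p)"
    using n1 by (simp add: node_def power_divide)
  finally have "integral {node N 1..1} (poly (p * p)) \<le> 10 * (real n)\<^sup>2 / (real N)\<^sup>2 * pint (p * p)" .
  moreover have "integral {0..1} (poly (p * p)) =
      integral {0..node N 1} (poly (p * p)) + integral {node N 1..1} (poly (p * p))"
    using n1 by (subst Henstock_Kurzweil_Integration.integral_combine) auto
  ultimately show ?thesis by linarith
qed

text \<open>With N = 10 n the error terms are absorbed: the two end pieces contribute 2 * 10/100 and
  the Bernstein terms 18/100 of the squared norm. The remaining 62/100 is at most 8 times the
  discrete norm, which leaves room for the factor 16.\<close>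

lemma frame:
  fixes u x :: "nat \<Rightarrow> real"
  assumes p: "deg_less n p" and n: "n > 0" and N: "N = 10 * n"
    and u: "\<And>i. i < m \<Longrightarrow> 0 \<le> u i"
    and cells: "\<And>j. j \<in> {1..<N} \<Longrightarrow>
      node N j - node N (Suc j) \<le> 4 * (\<Sum>i<m. u i * indicator (cell N j) (x i))"
    and cells': "\<And>j. j \<in> {1..<N} \<Longrightarrow>
      node N j - node N (Suc j) \<le> 4 * (\<Sum>i<m. u i * indicator (cell N j) (- x i))"
  shows "pint (p * p) \<le> 16 * (\<Sum>i<m. u i * (poly p (x i))\<^sup>2)"
proof -
  have "N > 0" using n N by simp
  define Q S where "Q = pint (p * p)" and "S = (\<Sum>i<m. u i * (poly p (x i))\<^sup>2)"
  define W where "W q = [:1, 0, -1:] * (pderiv q * pderiv q)" for q :: "real poly"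
  have NN: "(real N)\<^sup>2 = 100 * (real n)\<^sup>2" by (simp add: N power_mult_distrib)
  let ?r = "reflect p"
  \<comment> \<open>Reflection fixes 1 - x^2 and changes the sign of the derivative, which the
    square removes.\<close>
  have W_reflect: "W ?r = reflect (W p)"
    by (rule poly_eq_poly_eq_iff[THEN iffD1])
      (simp add: W_def fun_eq_iff reflect_def pderiv_pcompose poly_pcompose pderiv_pCons)
  have refl01: "integral {0..1} (poly (reflect q)) = integral {-1..0} (poly q)" for q
    using integral_reflect[of 0 "-1" q] by simp
  have pos: "integral {0..1} (poly (p * p)) \<le>
      8 * (\<Sum>i<m. u i * (poly p (x i))\<^sup>2 * indicator {0<..} (x i)) +
      18 / (real N)\<^sup>2 * integral {0..1} (poly (W p)) + Q / 10"
    using frame_nonneg[OF \<open>N > 0\<close> u cells, of p, folded W_def] tail_le[OF p \<open>N > 0\<close>, folded Q_def] n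
    by (simp add: NN)
  have "integral {0..node N 1} (poly (reflect (p * p))) \<le>
      8 * (\<Sum>i<m. u i * (poly p (x i))\<^sup>2 * indicator {0<..} (- x i)) +
      18 / (real N)\<^sup>2 * integral {-1..0} (poly (W p))"
    using frame_nonneg[OF \<open>N > 0\<close> u cells', of ?r]
    unfolding W_def[symmetric] W_reflect refl01 reflect_mult[symmetric] poly_reflect minus_minus .
  moreover have "integral {-1..0} (poly (p * p)) \<le>
      integral {0..node N 1} (poly (reflect (p * p))) + 10 * (real n)\<^sup>2 / (real N)\<^sup>2 * Q"
    using tail_le[OF deg_less_reflect[OF p] \<open>N > 0\<close>]
    unfolding reflect_mult[symmetric] pint_reflect refl01 Q_def .
  ultimately have neg: "integral {-1..0} (poly (p * p)) \<le>
      8 * (\<Sum>i<m. u i * (poly p (x i))\<^sup>2 * indicator {0<..} (- x i)) +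
      18 / (real N)\<^sup>2 * integral {-1..0} (poly (W p)) + Q / 10"
    using n by (simp add: NN)
  have "Q = integral {-1..0} (poly (p * p)) + integral {0..1} (poly (p * p))"
    by (simp add: Q_def pint_split)
  also have "\<dots> \<le> 8 * ((\<Sum>i<m. u i * (poly p (x i))\<^sup>2 * indicator {0<..} (x i)) +
      (\<Sum>i<m. u i * (poly p (x i))\<^sup>2 * indicator {0<..} (- x i))) +
      18 / (real N)\<^sup>2 * pint (W p) + Q / 5"
    using pos neg by (simp add: pint_split[of "W p"] distrib_left)
  also have "(\<Sum>i<m. u i * (poly p (x i))\<^sup>2 * indicator {0<..} (x i)) +
      (\<Sum>i<m. u i * (poly p (x i))\<^sup>2 * indicator {0<..} (- x i)) \<le> S"
    unfolding S_def sum.distrib[symmetric] using u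
    by (intro sum_mono) (auto simp: indicator_def)
  also have "18 / (real N)\<^sup>2 * pint (W p) \<le> 18 / (real N)\<^sup>2 * ((real n)\<^sup>2 * Q)"
    unfolding W_def Q_def by (intro mult_left_mono pint_bernstein[OF p]) simp
  also have "18 / (real N)\<^sup>2 * ((real n)\<^sup>2 * Q) = 18 / 100 * Q"
    using n by (simp add: NN)
  finally have "Q \<le> 8 * S + 18 / 100 * Q + Q / 5" by simp
  moreover have "0 \<le> Q" by (simp add: Q_def pint_square_nonneg)
  ultimately show ?thesis by (simp add: Q_def[symmetric] S_def[symmetric])
qed

subsection \<open>Jacobi sampling measures\<close>

abbreviation lebD :: "real measure" where
  "lebD \<equiv> restrict_space lborel D"

lemma D_borel [measurable, simp]: "D \<in> sets borel"
  by (simp add: D_def)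

lemma space_lebD [simp]: "space lebD = D"
  by (simp add: space_restrict_space)

lemma emeasure_lebD: "emeasure lebD D = 2"
  by (simp add: emeasure_restrict_space D_def)

lemma borel_measurable_lebD [measurable (raw)]: "f \<in> borel_measurable borel \<Longrightarrow> f \<in> borel_measurable lebD"
  by (simp add: measurable_restrict_space1)

lemma one_minus_square_pos: "x \<in> D \<Longrightarrow> 0 < 1 - x\<^sup>2"
  by (auto simp: D_def abs_square_less_1)

definition jacobi :: "real \<Rightarrow> real \<Rightarrow> real" where
  "jacobi \<beta> x = (1 - x\<^sup>2) powr \<beta>"

definition jacobi_mass :: "real \<Rightarrow> real" where
  "jacobi_mass \<beta> = (LBINT t:D. jacobi \<beta> t)"

lemma jacobi_measurable [measurable]: "jacobi \<beta> \<in> borel_measurable borel"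
  unfolding jacobi_def by measurable

lemma jacobi_nonneg [simp]: "0 \<le> jacobi \<beta> x"
  by (simp add: jacobi_def)

lemma jacobi_pos: "x \<in> D \<Longrightarrow> 0 < jacobi \<beta> x"
  using one_minus_square_pos[of x] by (simp add: jacobi_def)

lemma jacobi_mult: "x \<in> D \<Longrightarrow> jacobi \<alpha> x * jacobi \<beta> x = jacobi (\<alpha> + \<beta>) x"
  by (simp add: jacobi_def powr_add)

text \<open>Substitution from y^beta on [0, 2]; c = 1 and c = -1 give the singularities at the two
  endpoints.\<close>

lemma integrable_powr_affine:
  fixes c \<beta> :: real
  assumes "-1 < \<beta>" "c \<noteq> 0"
  shows "integrable lborel (\<lambda>x. indicator {0..2} (1 + c * x) * (1 + c * x) powr \<beta>)"
proof -
  have "(\<lambda>y. y powr \<beta>) absolutely_integrable_on {0..2}"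
    using assms by (intro nonnegative_absolutely_integrable_1 integrable_on_powr_from_0) auto
  then have "integrable lborel (\<lambda>y. indicator {0..2} y * y powr \<beta>)"
    unfolding set_integrable_def by (subst (asm) integrable_completion) auto
  then show ?thesis
    using lborel_integrable_real_affine[of _ c 1] assms by auto
qed

text \<open>For beta < 0 the inequality 1 - x^2 >= 1 - |x| reduces the density to one endpoint
  singularity; for beta >= 0 it is at most 1. The sum of the three majorants covers both
  cases.\<close>

lemma jacobi_integrable:
  assumes "-1 < \<beta>" shows "set_integrable lborel D (jacobi \<beta>)"
  unfolding set_integrable_def
proof (rule Bochner_Integration.integrable_bound)
  let ?g = "\<lambda>c x. indicator {0..2} (1 + c * x) * (1 + c * x) powr \<beta> :: real"
  show "integrable lborel (\<lambda>x. ?g 1 x + ?g (-1) x + indicator D x)"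
    by (intro Bochner_Integration.integrable_add integrable_powr_affine assms)
      (auto simp: D_def)
  show "(\<lambda>x. indicator D x *\<^sub>R jacobi \<beta> x) \<in> borel_measurable lborel" by measurable
  have le: "jacobi \<beta> x \<le> (1 + x) powr \<beta> + (1 - x) powr \<beta> + 1" if "x \<in> D" for x
  proof (cases "\<beta> \<ge> 0")
    case True
    then have "jacobi \<beta> x \<le> 1 powr \<beta>"
      unfolding jacobi_def using one_minus_square_pos[OF that] by (intro powr_mono2) auto
    then have "jacobi \<beta> x \<le> 1" by simp
    then show ?thesis using powr_ge_zero[of "1 + x" \<beta>] powr_ge_zero[of "1 - x" \<beta>] by linarith
  next
    case False
    have x: "-1 < x" "x < 1" using that by (auto simp: D_def)
    define y where "y = \<bar>x\<bar>"
    have y: "0 \<le> y" "y < 1" using x by (auto simp: y_def)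
    have "y * y \<le> y" using y by (intro mult_left_le) auto
    then have "1 - y \<le> 1 - x\<^sup>2" by (simp add: y_def power2_eq_square)
    then have "jacobi \<beta> x \<le> (1 - y) powr \<beta>"
      unfolding jacobi_def using False y by (intro powr_mono2') auto
    also have "\<dots> \<le> (1 + x) powr \<beta> + (1 - x) powr \<beta>" by (auto simp: y_def abs_if)
    finally show ?thesis by simp
  qed
  have "norm (indicator D x *\<^sub>R jacobi \<beta> x) \<le> norm (?g 1 x + ?g (-1) x + indicator D x)" for x
  proof (cases "x \<in> D")
    case True
    then have "1 + x \<in> {0..2}" "1 - x \<in> {0..2}" by (auto simp: D_def)
    then show ?thesis using True le[of x] by simp
  qed simp
  then show "AE x in lborel. norm (indicator D x *\<^sub>R jacobi \<beta> x)
      \<le> norm (?g 1 x + ?g (-1) x + indicator D x)" by simp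
qed

lemma nn_integral_lebD:
  "f \<in> borel_measurable lebD \<Longrightarrow> (\<integral>\<^sup>+x. f x \<partial>lebD) = (\<integral>\<^sup>+x. f x * indicator D x \<partial>lborel)"
  by (simp add: nn_integral_restrict_space)

lemma nn_integral_jacobi:
  assumes "-1 < \<beta>" shows "(\<integral>\<^sup>+x. ennreal (jacobi \<beta> x) \<partial>lebD) = ennreal (jacobi_mass \<beta>)"
proof -
  have "(\<integral>\<^sup>+x. ennreal (jacobi \<beta> x) \<partial>lebD) = (\<integral>\<^sup>+x. ennreal (indicator D x *\<^sub>R jacobi \<beta> x) \<partial>lborel)"
    by (subst nn_integral_lebD) (auto intro!: nn_integral_cong simp: indicator_def)
  also have "\<dots> = ennreal (jacobi_mass \<beta>)"
    using jacobi_integrable[OF assms]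
    unfolding jacobi_mass_def set_lebesgue_integral_def set_integrable_def
    by (subst nn_integral_eq_integral) (auto simp: indicator_def)
  finally show ?thesis .
qed

lemma jacobi_mass_pos:
  assumes "-1 < \<beta>" shows "0 < jacobi_mass \<beta>"
proof (rule ccontr)
  assume "\<not> 0 < jacobi_mass \<beta>"
  then have "(\<integral>\<^sup>+x. ennreal (jacobi \<beta> x) \<partial>lebD) = 0"
    unfolding nn_integral_jacobi[OF assms] by (simp add: ennreal_neg)
  then have "AE x in lebD. ennreal (jacobi \<beta> x) = 0"
    by (subst (asm) nn_integral_0_iff_AE) auto
  moreover have "AE x in lebD. x \<in> D" by (rule AE_I2) simp
  ultimately have "AE x in lebD. False"
  proof eventually_elim
    case (elim x)
    then show False using jacobi_pos[of x \<beta>] by (simp add: ennreal_eq_0_iff)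
  qed
  then have "emeasure lebD {x \<in> space lebD. \<not> False} = 0"
    by (subst (asm) AE_iff_measurable[OF _ refl]) (use sets.top[of lebD] in auto)
  then show False by (simp add: emeasure_lebD)
qed

lemma sampling_measure_eq:
  "sampling_measure \<beta> = density lebD (\<lambda>x. ennreal (jacobi \<beta> x / jacobi_mass \<beta>))"
  by (simp add: sampling_measure_def jacobi_def jacobi_mass_def)

lemma space_sampling [simp]: "space (sampling_measure \<beta>) = D"
  by (simp add: sampling_measure_eq)

lemma sets_sampling [measurable_cong, simp]: "sets (sampling_measure \<beta>) = sets lebD"
  by (simp add: sampling_measure_eq)

lemma nn_integral_sampling:
  assumes [measurable]: "h \<in> borel_measurable lebD"
  shows "(\<integral>\<^sup>+x. h x \<partial>sampling_measure \<beta>) =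
    (\<integral>\<^sup>+x. ennreal (jacobi \<beta> x / jacobi_mass \<beta>) * h x \<partial>lebD)"
  unfolding sampling_measure_eq by (subst nn_integral_density) auto

text \<open>Serves for the total mass (gamma = 0) and for the expected cost (gamma = -alpha); in the
  latter use the condition reads beta - alpha > -1.\<close>

lemma nn_integral_sampling_jacobi:
  assumes \<beta>: "-1 < \<beta>" and \<gamma>: "-1 < \<beta> + \<gamma>" and "K \<ge> 0"
  shows "(\<integral>\<^sup>+x. ennreal (K * jacobi \<gamma> x) \<partial>sampling_measure \<beta>) =
    ennreal (K * jacobi_mass (\<beta> + \<gamma>) / jacobi_mass \<beta>)"
proof -
  note pos = jacobi_mass_pos[OF \<beta>] jacobi_mass_pos[OF \<gamma>]
  have "(\<integral>\<^sup>+x. ennreal (K * jacobi \<gamma> x) \<partial>sampling_measure \<beta>) =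
      (\<integral>\<^sup>+x. ennreal (K / jacobi_mass \<beta>) * ennreal (jacobi (\<beta> + \<gamma>) x) \<partial>lebD)"
  proof (subst nn_integral_sampling, measurable, intro nn_integral_cong)
    fix x assume "x \<in> space lebD"
    then have "jacobi \<beta> x / jacobi_mass \<beta> * (K * jacobi \<gamma> x) =
        K / jacobi_mass \<beta> * jacobi (\<beta> + \<gamma>) x"
      using jacobi_mult[of x \<beta> \<gamma>] by (simp add: mult_ac)
    then show "ennreal (jacobi \<beta> x / jacobi_mass \<beta>) * ennreal (K * jacobi \<gamma> x) =
        ennreal (K / jacobi_mass \<beta>) * ennreal (jacobi (\<beta> + \<gamma>) x)"
      using pos \<open>K \<ge> 0\<close> by (simp flip: ennreal_mult)
  qed
  also have "\<dots> = ennreal (K / jacobi_mass \<beta> * jacobi_mass (\<beta> + \<gamma>))"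
    using pos \<open>K \<ge> 0\<close>
    by (subst nn_integral_cmult, measurable, subst nn_integral_jacobi[OF \<gamma>], subst ennreal_mult[symmetric]) auto
  finally show ?thesis by simp
qed

lemma prob_space_sampling:
  assumes "-1 < \<beta>" shows "prob_space (sampling_measure \<beta>)"
proof (rule prob_spaceI)
  have "(\<integral>\<^sup>+x. ennreal (1 * jacobi 0 x) \<partial>sampling_measure \<beta>) = (\<integral>\<^sup>+x. 1 \<partial>sampling_measure \<beta>)"
    by (intro nn_integral_cong) (use one_minus_square_pos in \<open>force simp: jacobi_def\<close>)
  then show "emeasure (sampling_measure \<beta>) (space (sampling_measure \<beta>)) = 1"
    using nn_integral_sampling_jacobi[of \<beta> 0 1] jacobi_mass_pos[OF assms] assms by simp
qed

section \<open>The uniform measure, the explicit weight and the Radon-Nikodym derivative\<close>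

lemma rho_eq: "rho = density lebD (\<lambda>_. ennreal (1 / 2))"
  unfolding rho_def uniform_measure_def
proof (rule density_cong)
  show "AE x in lebD. indicator D x / emeasure lebD D = ennreal (1 / 2)"
  proof (rule AE_I2)
    fix x assume "x \<in> space lebD"
    moreover have "(1 :: ennreal) / 2 = ennreal (1 / 2)"
      using divide_ennreal[of 1 2] by simp
    ultimately show "indicator D x / emeasure lebD D = ennreal (1 / 2)"
      by (simp add: emeasure_lebD)
  qed
qed auto

lemma space_rho [simp]: "space rho = D"
  by (simp add: rho_eq)

lemma sets_rho [measurable_cong, simp]: "sets rho = sets lebD"
  by (simp add: rho_eq)

lemma prob_space_rho: "prob_space rho"
  unfolding rho_def by (rule prob_space_uniform_measure) (auto simp: emeasure_lebD)

lemma nn_integral_rho: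
  "h \<in> borel_measurable lebD \<Longrightarrow> (\<integral>\<^sup>+x. h x \<partial>rho) = (\<integral>\<^sup>+x. ennreal (1 / 2) * h x \<partial>lebD)"
  unfolding rho_eq by (subst nn_integral_density) auto

definition jacobi_weight :: "real \<Rightarrow> real \<Rightarrow> real" where
  "jacobi_weight \<beta> x = jacobi_mass \<beta> / 2 * jacobi (- \<beta>) x"

lemma jacobi_weight_measurable [measurable]: "jacobi_weight \<beta> \<in> borel_measurable borel"
  unfolding jacobi_weight_def by measurable

lemma jacobi_weight_nonneg: "-1 < \<beta> \<Longrightarrow> 0 \<le> jacobi_weight \<beta> x"
  using jacobi_mass_pos[of \<beta>] by (simp add: jacobi_weight_def)

lemma jacobi_weight_density:
  assumes "-1 < \<beta>" "x \<in> D"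
  shows "jacobi \<beta> x / jacobi_mass \<beta> * jacobi_weight \<beta> x = 1 / 2"
  using jacobi_mass_pos[OF assms(1)] jacobi_mult[OF assms(2), of \<beta> "-\<beta>"] one_minus_square_pos[OF assms(2)]
  by (simp add: jacobi_weight_def field_simps) (simp add: jacobi_def)

text \<open>The importance sampling identity: every mean of a weighted quantity below becomes an
  integral against \<open>rho\<close>.\<close>

lemma nn_integral_weighted:
  assumes \<beta>: "-1 < \<beta>" and [measurable]: "h \<in> borel_measurable lebD"
  shows "(\<integral>\<^sup>+x. ennreal (jacobi_weight \<beta> x) * h x \<partial>sampling_measure \<beta>) = (\<integral>\<^sup>+x. h x \<partial>rho)"
proof -
  have "ennreal (jacobi \<beta> x / jacobi_mass \<beta>) * (ennreal (jacobi_weight \<beta> x) * h x) =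
      ennreal (1 / 2) * h x" if "x \<in> D" for x
    unfolding jacobi_weight_density[OF \<beta> that, symmetric]
    using jacobi_weight_nonneg[OF \<beta>] jacobi_mass_pos[OF \<beta>]
    by (subst ennreal_mult) (auto simp: mult.assoc)
  then show ?thesis
    by (subst nn_integral_sampling, measurable, subst nn_integral_rho)
       (auto intro!: nn_integral_cong)
qed

text \<open>The weight is defined through a Radon-Nikodym derivative, so it equals the explicit Jacobi
  weight only almost everywhere; the exceptional null set is later removed from the good event.\<close>

lemma weight_AE:
  assumes \<beta>: "-1 < \<beta>"
  shows "AE x in sampling_measure \<beta>. weight (sampling_measure \<beta>) x = jacobi_weight \<beta> x"
proof -
  interpret rho: prob_space rho by (rule prob_space_rho)
  let ?v = "\<lambda>x. ennreal (2 * jacobi \<beta> x / jacobi_mass \<beta>)"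
  have half: "ennreal (1 / 2) * ?v x = ennreal (jacobi \<beta> x / jacobi_mass \<beta>)" for x
    using jacobi_mass_pos[OF \<beta>] by (subst ennreal_mult[symmetric]) auto
  have "density rho ?v = sampling_measure \<beta>"
    unfolding rho_eq sampling_measure_eq
    by (subst density_density_eq, measurable, measurable, simp only: half)
  then have "AE x in rho. ?v x = RN_deriv rho (sampling_measure \<beta>) x"
    by (intro rho.RN_deriv_unique) measurable
  then have "AE x in lebD. ?v x = RN_deriv rho (sampling_measure \<beta>) x"
    unfolding rho_eq by (subst (asm) AE_density) auto
  moreover have "AE x in lebD. x \<in> D" by (rule AE_I2) simp
  ultimately have "AE x in lebD. weight (sampling_measure \<beta>) x = jacobi_weight \<beta> x"
  proof eventually_elim
    case (elim x)
    have v: "enn2real (RN_deriv rho (sampling_measure \<beta>) x) = 2 * (jacobi \<beta> x / jacobi_mass \<beta>)"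
      using jacobi_mass_pos[OF \<beta>] unfolding elim(1)[symmetric] by simp
    have *: "jacobi_weight \<beta> x * enn2real (RN_deriv rho (sampling_measure \<beta>) x) = 1"
    proof -
      have "w * (2 * a) = 1" if "a * w = 1 / 2" for a w :: real
        using that by (simp add: algebra_simps)
      from this[OF jacobi_weight_density[OF \<beta> elim(2)]] show ?thesis
        unfolding v .
    qed
    then have "enn2real (RN_deriv rho (sampling_measure \<beta>) x) \<noteq> 0" by auto
    then show ?case using * unfolding weight_def by (simp add: divide_eq_eq)
  qed
  then show ?thesis unfolding sampling_measure_eq by (subst AE_density) auto
qed

lemma weight_measurable [measurable]:
  "weight (sampling_measure \<beta>) \<in> borel_measurable lebD"
proof -
  have "RN_deriv rho (sampling_measure \<beta>) \<in> borel_measurable lebD"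
    using borel_measurable_RN_deriv[of rho "sampling_measure \<beta>"]
    by (simp cong: measurable_cong_sets)
  then show ?thesis unfolding weight_def[abs_def] by measurable
qed

lemma nn_integral_poly_rho:
  assumes "\<And>x. x \<in> D \<Longrightarrow> 0 \<le> poly q x"
  shows "(\<integral>\<^sup>+x. ennreal (poly q x) \<partial>rho) = ennreal (pint q / 2)"
proof -
  have [measurable]: "poly q \<in> borel_measurable borel"
    by (intro borel_measurable_continuous_onI continuous_intros)
  let ?f = "\<lambda>x. if x \<in> D then poly q x / 2 else 0"
  have "(\<integral>\<^sup>+x. ennreal (poly q x) \<partial>rho) = (\<integral>\<^sup>+x. ennreal (?f x) \<partial>lborel)"
  proof (subst nn_integral_rho, measurable, subst nn_integral_lebD, measurable, intro nn_integral_cong)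
    fix x
    show "ennreal (1 / 2) * ennreal (poly q x) * indicator D x = ennreal (?f x)"
      using assms[of x] ennreal_mult[of "1/2" "poly q x"] by (auto simp: indicator_def)
  qed
  also have "\<dots> = ennreal (pint q / 2)"
  proof (rule nn_integral_has_integral_lborel)
    have "(poly q has_integral pint q) {-1..1}"
      unfolding pint_def by (intro integrable_integral) simp
    then have "((\<lambda>x. poly q x / 2) has_integral pint q / 2) {-1..1}"
      by (rule has_integral_divide)
    then show "(?f has_integral pint q / 2) UNIV"
      by (simp only: has_integral_restrict_UNIV D_def has_integral_Icc_iff_Ioo)
  qed (use assms in auto)
  finally show ?thesis .
qed

subsection \<open>Concentration of the cell weights\<close>

text \<open>With t = s/4, this follows from (1 - t + t^2)(1 + t) = 1 + t^3 >= 1 and 1 + t <= exp t;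
  then t^2 <= s/16 because s <= 1. A bound linear in s is what an expectation can be applied
  to.\<close>

lemma exp_minus_le: "exp (- (s::real) / 4) \<le> 1 - 3 * s / 16" if "0 \<le> s" "s \<le> 1"
proof -
  define t where "t = s / 4"
  have t: "0 \<le> t" "t \<le> 1" using that by (auto simp: t_def)
  have "1 \<le> (1 - t + t\<^sup>2) * (1 + t)" using t by (simp add: power2_eq_square algebra_simps)
  also have "\<dots> \<le> (1 - t + t\<^sup>2) * exp t"
    using t by (intro mult_left_mono exp_ge_add_one_self) (auto intro: add_nonneg_nonneg)
  finally have "exp (- t) \<le> 1 - t + t\<^sup>2" by (simp add: exp_minus field_simps)
  also have "t\<^sup>2 \<le> s / 16"
    using mult_left_le[of s s] that by (simp add: t_def power2_eq_square)
  finally show ?thesis by (simp add: t_def)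
qed

section \<open>Tail bounds for i.i.d. samples\<close>

lemma measurable_coordinate:
  assumes "h \<in> measurable M N" "i < m"
  shows "(\<lambda>x. h (x i)) \<in> measurable (PiM {..<m} (\<lambda>_. M)) N"
  by (rule measurable_compose[where N = M and f = "\<lambda>x. x i"])
     (use assms measurable_component_singleton[of i "{..<m}" "\<lambda>_. M"] in auto)

lemma nn_integral_PiM_sum:
  assumes "prob_space M" and h: "h \<in> borel_measurable M"
  shows "(\<integral>\<^sup>+x. (\<Sum>i<m. h (x i)) \<partial>PiM {..<m} (\<lambda>_. M)) = of_nat m * (\<integral>\<^sup>+x. h x \<partial>M)"
proof -
  interpret product_prob_space "\<lambda>_. M" "{..<m}"
    using assms(1) by (simp add: product_prob_space_def product_sigma_finite_def
        product_prob_space_axioms_def prob_space_imp_sigma_finite)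
  have "(\<integral>\<^sup>+x. h (x i) \<partial>PiM {..<m} (\<lambda>_. M)) = (\<integral>\<^sup>+x. h x \<partial>M)" if "i < m" for i
  proof -
    have "(\<integral>\<^sup>+x. h x \<partial>distr (PiM {..<m} (\<lambda>_. M)) M (\<lambda>x. x i)) =
        (\<integral>\<^sup>+x. h (x i) \<partial>PiM {..<m} (\<lambda>_. M))"
      using that h by (intro nn_integral_distr measurable_component_singleton) auto
    then show ?thesis using that by (simp add: PiM_component)
  qed
  then show ?thesis
    using h by (subst nn_integral_sum) (auto intro: measurable_coordinate)
qed

text \<open>For the lower tail, the mean and the upper bound W of a nonnegative variable suffice:
  \<open>exp_minus_le\<close> linearises exp (-X / (4W)). The exponents combine as 3/16 - 1/8 =
  1/16.\<close>

lemma chernoff_lower_tail: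
  assumes M: "prob_space M" and [measurable]: "X \<in> borel_measurable M"
    and X: "\<And>x. x \<in> space M \<Longrightarrow> 0 \<le> X x" "\<And>x. x \<in> space M \<Longrightarrow> X x \<le> W"
    and W: "0 < W" and q: "(\<integral>\<^sup>+x. ennreal (X x) \<partial>M) = ennreal q" "0 \<le> q"
  shows "measure (PiM {..<m} (\<lambda>_. M))
      {x \<in> space (PiM {..<m} (\<lambda>_. M)). (\<Sum>i<m. X (x i)) < real m * q / 2}
    \<le> exp (- (real m * q / (16 * W)))" (is "measure ?P ?A \<le> _")
proof -
  interpret prob_space M by (rule M)
  interpret P: prob_space ?P by (rule prob_space_PiM) (rule M)
  interpret product_sigma_finite "\<lambda>_. M"
    by (simp add: product_sigma_finite_def prob_space_imp_sigma_finite M)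
  have [measurable]: "(\<lambda>x. X (x i)) \<in> borel_measurable ?P" if "i < m" for i
    using that by (intro measurable_coordinate) measurable
  define Y where "Y x = exp (- (X x / W) / 4)" for x
  have [measurable]: "Y \<in> borel_measurable M" unfolding Y_def[abs_def] by measurable
  have intX: "integrable M X"
    using X by (intro integrable_const_bound[of _ W] AE_I2) auto
  have EX: "expectation X = q"
    using q X by (simp add: integral_eq_nn_integral AE_I2)
  have Y: "0 \<le> Y x" "Y x \<le> 1 - 3 * X x / (16 * W)" if "x \<in> space M" for x
    using exp_minus_le[of "X x / W"] X[OF that] W by (auto simp: Y_def)
  have "(\<integral>\<^sup>+x. ennreal (Y x) \<partial>M) \<le> (\<integral>\<^sup>+x. ennreal (1 - 3 * X x / (16 * W)) \<partial>M)"
    using Y by (intro nn_integral_mono ennreal_leI) auto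
  also have "\<dots> = ennreal (expectation (\<lambda>x. 1 - 3 * X x / (16 * W)))"
  proof (rule nn_integral_eq_integral)
    show "AE x in M. 0 \<le> 1 - 3 * X x / (16 * W)"
      using Y by (intro AE_I2) (meson order_trans)
  qed (use intX in auto)
  also have "expectation (\<lambda>x. 1 - 3 * X x / (16 * W)) = 1 - 3 * q / (16 * W)"
    using intX EX by (simp add: prob_space)
  also have "\<dots> \<le> exp (- (3 * q / (16 * W)))"
    using exp_ge_add_one_self[of "- (3 * q / (16 * W))"] by simp
  finally have EY: "(\<integral>\<^sup>+x. ennreal (Y x) \<partial>M) \<le> ennreal (exp (- (3 * q / (16 * W))))"
    by (simp add: ennreal_leI)
  \<comment> \<open>This is exp (s / (4W)) at the threshold s = m q / 2, so that on the event
    \<open>c\<close> times the product is at least 1.\<close>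
  define c where "c = exp (real m * q / (8 * W))"
  have "?A \<subseteq> {x \<in> space ?P. 1 \<le> ennreal c * (\<Prod>i<m. ennreal (Y (x i)))}"
  proof safe
    fix x assume x: "(\<Sum>i<m. X (x i)) < real m * q / 2"
    have "(\<Prod>i<m. Y (x i)) = exp (- ((\<Sum>i<m. X (x i)) / (4 * W)))"
      by (simp add: Y_def exp_sum[symmetric] sum_negf sum_divide_distrib mult.commute)
    then have "c * (\<Prod>i<m. Y (x i)) = exp (real m * q / (8 * W) - (\<Sum>i<m. X (x i)) / (4 * W))"
      by (simp add: c_def exp_diff exp_minus field_simps)
    moreover have "0 \<le> real m * q / (8 * W) - (\<Sum>i<m. X (x i)) / (4 * W)"
      using x W by (simp add: field_simps)
    ultimately have "1 \<le> c * (\<Prod>i<m. Y (x i))" by simp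
    then have "ennreal 1 \<le> ennreal (c * (\<Prod>i<m. Y (x i)))" by (rule ennreal_leI)
    then show "1 \<le> ennreal c * (\<Prod>i<m. ennreal (Y (x i)))"
      by (simp add: c_def Y_def ennreal_mult prod_nonneg flip: prod_ennreal)
  qed
  then have "emeasure ?P ?A \<le> emeasure ?P {x \<in> space ?P. 1 \<le> ennreal c * (\<Prod>i<m. ennreal (Y (x i)))}"
    by (intro emeasure_mono) (auto intro!: measurable_coordinate)
  also have "\<dots> \<le> ennreal c * (\<integral>\<^sup>+x. (\<Prod>i<m. ennreal (Y (x i))) * indicator (space ?P) x \<partial>?P)"
    by (intro nn_integral_Markov_inequality)
       (auto intro!: borel_measurable_times borel_measurable_prod measurable_coordinate)
  also have "(\<integral>\<^sup>+x. (\<Prod>i<m. ennreal (Y (x i))) * indicator (space ?P) x \<partial>?P) =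
      (\<integral>\<^sup>+x. (\<Prod>i<m. ennreal (Y (x i))) \<partial>?P)"
    by (intro nn_integral_cong) simp
  also have "\<dots> = (\<integral>\<^sup>+x. ennreal (Y x) \<partial>M) ^ m"
    by (subst product_nn_integral_prod) auto
  also have "\<dots> \<le> ennreal (exp (- (3 * q / (16 * W)))) ^ m"
    using EY by (rule power_mono) simp
  also have "ennreal c * \<dots> = ennreal (c * exp (- (3 * q / (16 * W))) ^ m)"
    by (simp add: ennreal_power c_def flip: ennreal_mult)
  also have "c * exp (- (3 * q / (16 * W))) ^ m = exp (- (real m * q / (16 * W)))"
    using W by (simp add: c_def field_simps flip: exp_of_nat_mult exp_add)
  finally show ?thesis by (simp add: P.emeasure_eq_measure mult_left_mono)
qed

text \<open>Strictness of the event admits E = 0, which occurs when \<open>f\<close> equals the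
  approximating polynomial almost everywhere; the event is then null. Otherwise this is Markov's
  inequality after division by E.\<close>

lemma markov_tail:
  assumes "prob_space P" and [measurable]: "X \<in> borel_measurable P"
    and X: "(\<integral>\<^sup>+x. ennreal (X x) \<partial>P) \<le> ennreal E" and E: "0 \<le> E" and c: "0 < c"
  shows "measure P {x \<in> space P. c * E < X x} \<le> 1 / c"
proof -
  interpret prob_space P by fact
  show ?thesis
  proof (cases "E = 0")
    case True
    then have "(\<integral>\<^sup>+x. ennreal (X x) \<partial>P) = 0" using X by simp
    then have "AE x in P. ennreal (X x) = 0"
      by (subst (asm) nn_integral_0_iff_AE) auto
    then have "AE x in P. \<not> c * E < X x"
      using True by (auto simp: ennreal_eq_0_iff elim!: eventually_mono)
    then have "measure P {x \<in> space P. c * E < X x} = 0"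
      by (subst (asm) AE_iff_measurable[OF _ refl]) (auto simp: measure_def)
    then show ?thesis using c by simp
  next
    case False
    then have "0 < E" using E by simp
    have "{x \<in> space P. c * E < X x} \<subseteq> {x \<in> space P. 1 \<le> ennreal (1 / (c * E)) * ennreal (X x)}"
    proof safe
      fix x assume "c * E < X x"
      then have "1 \<le> 1 / (c * E) * X x" using \<open>0 < E\<close> c by (simp add: field_simps)
      then have "ennreal 1 \<le> ennreal (1 / (c * E) * X x)" by (rule ennreal_leI)
      then show "1 \<le> ennreal (1 / (c * E)) * ennreal (X x)"
        using \<open>0 < E\<close> c by (subst ennreal_mult'[symmetric]) auto
    qed
    then have "emeasure P {x \<in> space P. c * E < X x} \<le>
        emeasure P {x \<in> space P. 1 \<le> ennreal (1 / (c * E)) * ennreal (X x)}"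
      by (intro emeasure_mono) auto
    also have "\<dots> \<le> ennreal (1 / (c * E)) * (\<integral>\<^sup>+x. ennreal (X x) * indicator (space P) x \<partial>P)"
      by (intro nn_integral_Markov_inequality) auto
    also have "(\<integral>\<^sup>+x. ennreal (X x) * indicator (space P) x \<partial>P) = (\<integral>\<^sup>+x. ennreal (X x) \<partial>P)"
      by (intro nn_integral_cong) simp
    also have "ennreal (1 / (c * E)) * \<dots> \<le> ennreal (1 / (c * E)) * ennreal E"
      using X by (rule mult_left_mono) simp
    also have "\<dots> = ennreal (1 / c)"
      using \<open>0 < E\<close> c by (simp flip: ennreal_mult)
    finally show ?thesis using c by (simp add: emeasure_eq_measure)
  qed
qed

text \<open>The maximal weight on a cell in units of the cell length; this ratio sets the sample
  size. In t^(-beta) = t^(-(beta+1/2)) t^(1/2), the first factor is largest at t = N^(-2) because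
  beta >= -1/2, and the second is of order j/N, that is, of N times the cell length.\<close>

lemma jacobi_weight_cell_le:
  assumes \<beta>: "-1/2 \<le> \<beta>" and j: "j \<in> {1..<N}" and x: "\<bar>x\<bar> \<in> cell N j"
  shows "jacobi_weight \<beta> x \<le>
    (node N j - node N (Suc j)) * jacobi_mass \<beta> * real N powr (2 * \<beta> + 2)"
proof -
  have N: "0 < real N" and j1: "1 \<le> real j" using j by auto
  define y where "y = \<bar>x\<bar>"
  have y: "0 < y" "(real j / real N)\<^sup>2 \<le> 1 - y" "1 - y \<le> (real (Suc j) / real N)\<^sup>2"
    using x node_nonneg[of "Suc j" N] j by (auto simp: cell_def node_def y_def)
  have "0 < (real j / real N)\<^sup>2" using j by simp
  then have "y < 1" using y by linarith
  define t where "t = 1 - x\<^sup>2"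
  have t_eq: "t = (1 - y) * (1 + y)" by (simp add: t_def y_def power2_eq_square algebra_simps)
  have "(1 / real N)\<^sup>2 \<le> (real j / real N)\<^sup>2"
    using N j1 by (intro power_mono divide_right_mono) auto
  also have "\<dots> \<le> (1 - y) * 1" using y by simp
  also have "\<dots> \<le> t" unfolding t_eq using y \<open>y < 1\<close> by (intro mult_left_mono) auto
  finally have t1: "(1 / real N)\<^sup>2 \<le> t" .
  have "t \<le> (1 - y) * 2" unfolding t_eq using y \<open>y < 1\<close> by (intro mult_left_mono) auto
  \<comment> \<open>The factor 2 is enlarged to 2^2 so that the bound is a perfect square when the
    root is taken.\<close>
  also have "\<dots> \<le> (real (Suc j) / real N)\<^sup>2 * 2\<^sup>2" using y \<open>y < 1\<close> by simp
  also have "\<dots> = (2 * real (Suc j) / real N)\<^sup>2" by (simp only: power_mult_distrib power_divide times_divide_eq_right mult.commute)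
  finally have t2: "t \<le> (2 * real (Suc j) / real N)\<^sup>2" .
  have "0 < t" using t1 N by (smt (verit) zero_less_power divide_pos_pos)
  have "jacobi (- \<beta>) x = t powr (- (\<beta> + 1/2)) * t powr (1/2)"
    by (simp add: jacobi_def t_def[symmetric] flip: powr_add)
  also have "\<dots> \<le> ((1 / real N)\<^sup>2) powr (- (\<beta> + 1/2)) * (2 * real (Suc j) / real N)"
  proof (rule mult_mono)
    show "t powr - (\<beta> + 1 / 2) \<le> ((1 / real N)\<^sup>2) powr - (\<beta> + 1 / 2)"
      using \<beta> N t1 by (intro powr_mono2') auto
    have "t powr (1/2) = sqrt t" using \<open>0 < t\<close> by (simp add: powr_half_sqrt)
    also have "\<dots> \<le> 2 * real (Suc j) / real N"
      using t2 by (intro real_le_lsqrt) (auto simp: \<open>0 < t\<close> less_imp_le)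
    finally show "t powr (1 / 2) \<le> 2 * real (Suc j) / real N" .
  qed auto
  also have "((1 / real N)\<^sup>2) powr (- (\<beta> + 1/2)) = real N powr (2 * \<beta> + 1)"
  proof -
    have "(1 / real N)\<^sup>2 = real N powr (-2)"
      using N by (simp add: powr_minus powr_realpow[of _ 2, simplified] power_divide divide_simps)
    then show ?thesis by (simp add: powr_powr add.commute)
  qed
  also have "real N powr (2 * \<beta> + 1) * (2 * real (Suc j) / real N) =
      (2 * real (Suc j)) / (real N)\<^sup>2 * real N powr (2 * \<beta> + 2)"
  proof -
    have "real N powr (2 * \<beta> + 2) = real N powr (2 * \<beta> + 1) * real N"
      using N powr_add[of "real N" "2 * \<beta> + 1" 1] by (simp add: add.commute)
    then show ?thesis using N by (simp add: power2_eq_square)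
  qed
  also have "\<dots> \<le> (2 * (node N j - node N (Suc j))) * real N powr (2 * \<beta> + 2)"
    unfolding node_diff using N j1 by (intro mult_right_mono) (auto simp: divide_simps)
  finally have "jacobi (- \<beta>) x \<le> 2 * (node N j - node N (Suc j)) * real N powr (2 * \<beta> + 2)" .
  then have "jacobi_mass \<beta> / 2 * jacobi (- \<beta>) x \<le>
      jacobi_mass \<beta> / 2 * (2 * (node N j - node N (Suc j)) * real N powr (2 * \<beta> + 2))"
    using jacobi_mass_pos[of \<beta>] \<beta> by (intro mult_left_mono) auto
  then show ?thesis by (simp add: jacobi_weight_def algebra_simps)
qed

lemma nn_integral_weight_cell:
  assumes \<beta>: "-1 < \<beta>" and j: "j \<in> {1..<N}" and s: "s \<in> {1, -1}"
  shows "(\<integral>\<^sup>+x. ennreal (jacobi_weight \<beta> x * indicator (cell N j) (s * x)) \<partial>sampling_measure \<beta>) =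
    ennreal ((node N j - node N (Suc j)) / 2)"
proof -
  define C where "C = {x. s * x \<in> cell N j}"
  have l: "node N (Suc j) \<le> node N j" by (rule node_antimono) simp
  have b: "0 \<le> node N (Suc j)" "node N j < 1"
    using j node_nonneg[of "Suc j" N] by (auto simp: node_def)
  have C: "C = {node N (Suc j)<..node N j} \<or> C = {- node N j..<- node N (Suc j)}"
    using s by (auto simp: C_def cell_def)
  then have [measurable]: "C \<in> sets borel" by auto
  have CD: "C \<subseteq> D" using C b by (auto simp: D_def)
  have ind: "indicator (cell N j) (s * x) = (indicator C x :: real)" for x
    by (simp add: C_def indicator_def)
  have "(\<integral>\<^sup>+x. ennreal (jacobi_weight \<beta> x * indicator (cell N j) (s * x)) \<partial>sampling_measure \<beta>) =
      (\<integral>\<^sup>+x. ennreal (jacobi_weight \<beta> x) * indicator C x \<partial>sampling_measure \<beta>)"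
    unfolding ind using jacobi_weight_nonneg[OF \<beta>]
    by (intro nn_integral_cong) (auto simp: indicator_def)
  also have "\<dots> = (\<integral>\<^sup>+x. indicator C x \<partial>rho)"
    by (rule nn_integral_weighted[OF \<beta>]) measurable
  also have "\<dots> = (\<integral>\<^sup>+x. ennreal (1 / 2) * indicator C x \<partial>lborel)"
    using CD by (subst nn_integral_rho, measurable, subst nn_integral_lebD, measurable,
        intro nn_integral_cong) (auto simp: indicator_def)
  also have "\<dots> = ennreal (1 / 2) * emeasure lborel C"
    by (simp add: nn_integral_cmult)
  also have "emeasure lborel C = ennreal (node N j - node N (Suc j))"
    using C l by auto
  also have "ennreal (1 / 2) * \<dots> = ennreal ((node N j - node N (Suc j)) / 2)"
    using l by (subst ennreal_mult[symmetric]) auto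
  finally show ?thesis .
qed

text \<open>The factor \<open>160 = 32 * 5\<close>: the Chernoff exponent of a cell is
  \<open>m / (32 * jacobi_mass \<beta> * (10 * n) powr (2 * \<beta> + 2))\<close>, and its being at least
  \<open>5 * ln (3 * n / \<epsilon>)\<close> absorbs the union bound over the fewer than \<open>20 * n\<close> cells.\<close>

lemma good_samples:
  fixes g :: "real \<Rightarrow> real"
  assumes \<beta>: "-1/2 \<le> \<beta>" and n: "1 \<le> n" and \<epsilon>: "0 < \<epsilon>" "\<epsilon> < 1"
    and m: "160 * jacobi_mass \<beta> * 10 powr (2 * \<beta> + 2) * real n powr (2 * \<beta> + 2) * ln (3 * real n / \<epsilon>)
      \<le> real m"
    and g: "g \<in> borel_measurable lebD" "\<And>x. 0 \<le> g x"
      "(\<integral>\<^sup>+x. ennreal (g x) \<partial>rho) \<le> ennreal G" "0 \<le> G"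
  defines "\<mu> \<equiv> sampling_measure \<beta>" and "N \<equiv> 10 * n"
  obtains A where "A \<in> sets (PiM {..<m} (\<lambda>_. \<mu>))" "1 - \<epsilon> \<le> measure (PiM {..<m} (\<lambda>_. \<mu>)) A"
    "\<And>x i. x \<in> A \<Longrightarrow> i < m \<Longrightarrow> weight \<mu> (x i) = jacobi_weight \<beta> (x i)"
    "\<And>x. x \<in> A \<Longrightarrow> (\<Sum>i<m. jacobi_weight \<beta> (x i) * g (x i)) \<le> 4 / \<epsilon> * (real m * G)"
    "\<And>x. x \<in> A \<Longrightarrow> (\<Sum>i<m. jacobi_weight \<beta> (x i)) \<le> 4 / \<epsilon> * real m"
    "\<And>x j s. x \<in> A \<Longrightarrow> j \<in> {1..<N} \<Longrightarrow> s \<in> {1, -1} \<Longrightarrow>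
      real m * (node N j - node N (Suc j))
        \<le> 4 * (\<Sum>i<m. jacobi_weight \<beta> (x i) * indicator (cell N j) (s * x i))"
proof -
  have \<beta>1: "-1 < \<beta>" using \<beta> by simp
  note [measurable] = g(1)
  note w0 = jacobi_weight_nonneg[OF \<beta>1]
  define P where "P = PiM {..<m} (\<lambda>_. \<mu>)"
  have \<mu>: "prob_space \<mu>" unfolding \<mu>_def by (rule prob_space_sampling[OF \<beta>1])
  interpret Q: prob_space P unfolding P_def by (rule prob_space_PiM) (rule \<mu>)
  interpret product_prob_space "\<lambda>_. \<mu>" "{..<m}"
    using \<mu> by (simp add: product_prob_space_def product_sigma_finite_def
        product_prob_space_axioms_def prob_space_imp_sigma_finite)
  have meas: "(\<lambda>x. h (x i)) \<in> borel_measurable P" if "h \<in> borel_measurable lebD" "i < m"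
    for i and h :: "real \<Rightarrow> real"
    unfolding P_def using that by (intro measurable_coordinate) (simp_all add: \<mu>_def cong: measurable_cong_sets)
  have Esum: "(\<integral>\<^sup>+x. ennreal (\<Sum>i<m. jacobi_weight \<beta> (x i) * h (x i)) \<partial>P) =
      of_nat m * (\<integral>\<^sup>+x. ennreal (h x) \<partial>rho)"
    if [measurable]: "h \<in> borel_measurable lebD" and h: "\<And>x. 0 \<le> h x" for h
  proof -
    have "(\<integral>\<^sup>+x. ennreal (\<Sum>i<m. jacobi_weight \<beta> (x i) * h (x i)) \<partial>P) =
        (\<integral>\<^sup>+x. (\<Sum>i<m. ennreal (jacobi_weight \<beta> (x i)) * ennreal (h (x i))) \<partial>P)"
      using w0 h by (simp add: ennreal_mult flip: sum_ennreal)
    also have "\<dots> = of_nat m * (\<integral>\<^sup>+x. ennreal (jacobi_weight \<beta> x) * ennreal (h x) \<partial>\<mu>)"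
      unfolding P_def \<mu>_def
      by (rule nn_integral_PiM_sum[OF \<mu>[unfolded \<mu>_def]]) measurable
    finally show ?thesis
      unfolding \<mu>_def by (subst (asm) nn_integral_weighted[OF \<beta>1]) measurable
  qed

  \<comment> \<open>The bad events: a wrong value of the weight, a large residual, a large total
    weight, a cell with too little weight. \<open>B0\<close> is null; \<open>B1\<close>,
    \<open>B2\<close> and the union of the \<open>B3\<close> have probability at most \<epsilon> / 4
    each.\<close>
  define B0 where "B0 = {x \<in> space P. \<not> (\<forall>i\<in>{..<m}. weight \<mu> (x i) = jacobi_weight \<beta> (x i))}"
  define B1 where "B1 = {x \<in> space P. 4 / \<epsilon> * (real m * G) < (\<Sum>i<m. jacobi_weight \<beta> (x i) * g (x i))}"
  define B2 where "B2 = {x \<in> space P. 4 / \<epsilon> * real m < (\<Sum>i<m. jacobi_weight \<beta> (x i))}"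
  define B3 where "B3 js = {x \<in> space P. (\<Sum>i<m. jacobi_weight \<beta> (x i) *
      indicator (cell N (fst js)) (snd js * x i)) <
      real m * ((node N (fst js) - node N (Suc (fst js))) / 2) / 2}" for js :: "nat \<times> real"
  \<comment> \<open>The sign chooses between a cell and its mirror image.\<close>
  define J :: "(nat \<times> real) set" where "J = {1..<N} \<times> {1, -1}"

  have [measurable]: "(\<lambda>x. weight \<mu> (x i)) \<in> borel_measurable P"
    "(\<lambda>x. jacobi_weight \<beta> (x i)) \<in> borel_measurable P"
    "(\<lambda>x. g (x i)) \<in> borel_measurable P" if "i \<in> {..<m}" for i
    using that by (auto intro!: meas simp: \<mu>_def)
  have [measurable]: "(\<lambda>x. indicator (cell N j) (s * x i) :: real) \<in> borel_measurable P"
    if "i \<in> {..<m}" for i j s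
  proof -
    have "(\<lambda>y. indicator (cell N j) (s * y) :: real) \<in> borel_measurable lebD"
      unfolding cell_def by measurable
    from meas[OF this] show ?thesis using that by simp
  qed
  have "B0 = (\<Union>i\<in>{..<m}. {x \<in> space P. weight \<mu> (x i) \<noteq> jacobi_weight \<beta> (x i)})"
    by (auto simp: B0_def)
  also have "\<dots> \<in> sets P" by (intro sets.finite_UN borel_measurable_neq) measurable
  finally have [measurable]: "B0 \<in> sets P" .
  have [measurable]: "B1 \<in> sets P" unfolding B1_def by measurable
  have [measurable]: "B2 \<in> sets P" unfolding B2_def by measurable
  have [measurable]: "B3 js \<in> sets P" for js unfolding B3_def by measurable

  have "AE x in P. \<forall>i\<in>{..<m}. weight \<mu> (x i) = jacobi_weight \<beta> (x i)"
    using AE_component[OF _ weight_AE[OF \<beta>1, folded \<mu>_def]]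
    unfolding P_def by (subst AE_ball_countable) auto
  then have B0: "measure P B0 = 0"
    unfolding B0_def by (subst (asm) AE_iff_measurable[OF _ refl])
      (use \<open>B0 \<in> sets P\<close> in \<open>auto simp: measure_def B0_def\<close>)
  have B1: "measure P B1 \<le> \<epsilon> / 4"
  proof -
    have "of_nat m * (\<integral>\<^sup>+x. ennreal (g x) \<partial>rho) \<le> of_nat m * ennreal G"
      by (rule mult_left_mono[OF g(3)]) simp
    then have "measure P B1 \<le> 1 / (4 / \<epsilon>)"
      unfolding B1_def using \<epsilon> g
      by (intro markov_tail) (auto simp: Q.prob_space_axioms Esum ennreal_mult ennreal_of_nat_eq_real_of_nat)
    then show ?thesis by simp
  qed
  have B2: "measure P B2 \<le> \<epsilon> / 4"
  proof -
    interpret rho: prob_space rho by (rule prob_space_rho)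
    have "(\<integral>\<^sup>+x. ennreal (\<Sum>i<m. jacobi_weight \<beta> (x i) * 1) \<partial>P) = ennreal (real m)"
      by (subst Esum) (use rho.emeasure_space_1 in \<open>auto simp: ennreal_of_nat_eq_real_of_nat\<close>)
    then have "measure P B2 \<le> 1 / (4 / \<epsilon>)"
      unfolding B2_def using \<epsilon>
      by (intro markov_tail) (auto simp: Q.prob_space_axioms)
    then show ?thesis by simp
  qed
  define L where "L = ln (3 * real n / \<epsilon>)"
  have B3: "measure P (B3 js) \<le> exp (- (5 * L))" if js: "js \<in> J" for js
  proof -
    obtain j s where jseq: "js = (j, s)" and j: "j \<in> {1..<N}" and s: "s \<in> {1, -1}"
      using js by (auto simp: J_def)
    define l W where "l = node N j - node N (Suc j)"
      and "W = l * jacobi_mass \<beta> * real N powr (2 * \<beta> + 2)"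
    have l: "0 < l" using j by (simp add: l_def node_diff)
    note Z = jacobi_mass_pos[OF \<beta>1]
    have W: "0 < W" using l Z j by (simp add: W_def)
    have "measure P (B3 js) \<le> exp (- (real m * (l / 2) / (16 * W)))"
      unfolding B3_def P_def jseq fst_conv snd_conv l_def[symmetric]
    proof (rule chernoff_lower_tail[OF \<mu> _ _ _ W])
      show "(\<lambda>x. jacobi_weight \<beta> x * indicator (cell N j) (s * x)) \<in> borel_measurable \<mu>"
        unfolding \<mu>_def cell_def by measurable
      show "0 \<le> jacobi_weight \<beta> x * indicator (cell N j) (s * x)" for x
        using w0 by simp
      show "jacobi_weight \<beta> x * indicator (cell N j) (s * x) \<le> W" for x
      proof (cases "s * x \<in> cell N j")
        case True
        then have "0 < s * x" using node_nonneg[of "Suc j" N] j by (auto simp: cell_def)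
        then have "s * x = \<bar>x\<bar>" using s by auto
        then show ?thesis
          using True jacobi_weight_cell_le[OF \<beta> j, of x] by (simp add: W_def l_def)
      qed (use W in simp)
      show "(\<integral>\<^sup>+x. ennreal (jacobi_weight \<beta> x * indicator (cell N j) (s * x)) \<partial>\<mu>) = ennreal (l / 2)"
        unfolding \<mu>_def l_def by (rule nn_integral_weight_cell[OF \<beta>1 j s])
    qed (use l in simp)
    also have "real m * (l / 2) / (16 * W) = real m / (32 * jacobi_mass \<beta> * real N powr (2 * \<beta> + 2))"
      using l by (simp add: W_def)
    also have "real N powr (2 * \<beta> + 2) = 10 powr (2 * \<beta> + 2) * real n powr (2 * \<beta> + 2)"
      by (simp add: N_def powr_mult)
    finally have "measure P (B3 js) \<le>
        exp (- (real m / (32 * jacobi_mass \<beta> * (10 powr (2 * \<beta> + 2) * real n powr (2 * \<beta> + 2)))))" .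
    also have "\<dots> \<le> exp (- (5 * L))"
      using m Z n by (simp add: L_def pos_le_divide_eq mult_ac)
    finally show ?thesis .
  qed
  have "measure P (\<Union>js\<in>J. B3 js) \<le> (\<Sum>js\<in>J. measure P (B3 js))"
    by (intro measure_UNION_le) (auto simp: J_def)
  also have "\<dots> \<le> real (card J) * exp (- (5 * L))"
    using sum_bounded_above[of J "\<lambda>js. measure P (B3 js)"] B3 by auto
  also have "\<dots> \<le> 20 * real n * exp (- (5 * L))"
    by (intro mult_right_mono) (auto simp: J_def N_def)
  also have "\<dots> \<le> \<epsilon> / 4"
  proof -
    \<comment> \<open>Of the five factors r, one cancels n and the other four are at most 1/3 each,
      which gives 20/243 of \<epsilon>, less than a quarter.\<close>
    define r where "r = \<epsilon> / (3 * real n)"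
    have r: "0 < r" "r \<le> 1 / 3" using n \<epsilon> by (auto simp: r_def field_simps)
    have "exp (- L) = r" using n \<epsilon> by (simp add: L_def exp_minus r_def)
    then have "exp (- (5 * L)) = r ^ 5"
      using exp_of_nat_mult[of 5 "-L"] by simp
    also have "\<dots> = r ^ 4 * r" by (simp add: eval_nat_numeral)
    also have "\<dots> \<le> (1 / 3) ^ 4 * r"
      using r by (intro mult_right_mono power_mono) auto
    finally have "20 * real n * exp (- (5 * L)) \<le> 20 * real n * ((1 / 3) ^ 4 * r)"
      by (rule mult_left_mono) simp
    also have "\<dots> \<le> \<epsilon> / 4" using n \<epsilon> by (simp add: r_def eval_nat_numeral)
    finally show ?thesis .
  qed
  finally have B3': "measure P (\<Union>js\<in>J. B3 js) \<le> \<epsilon> / 4" .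

  define B where "B = B0 \<union> B1 \<union> B2 \<union> (\<Union>js\<in>J. B3 js)"
  have "finite J" by (simp add: J_def)
  then have [measurable]: "B \<in> sets P" unfolding B_def by (intro sets.Un sets.finite_UN) auto
  have "measure P B \<le> measure P B0 + measure P B1 + measure P B2 + measure P (\<Union>js\<in>J. B3 js)"
    unfolding B_def using \<open>finite J\<close>
    by (intro order_trans[OF measure_Un_le] add_mono order_refl) auto
  then have "measure P B \<le> \<epsilon>" using B0 B1 B2 B3' \<epsilon> by simp
  then have "1 - \<epsilon> \<le> measure P (space P - B)"
    by (subst Q.prob_compl) auto
  then show thesis
  proof (rule that[of "space P - B", folded P_def, rotated])
    show "space P - B \<in> sets P" by measurable
    show "real m * (node N j - node N (Suc j))
        \<le> 4 * (\<Sum>i<m. jacobi_weight \<beta> (x i) * indicator (cell N j) (s * x i))"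
      if "x \<in> space P - B" "j \<in> {1..<N}" "s \<in> {1, -1}" for x j s
    proof -
      have "x \<notin> B3 (j, s)" "x \<in> space P" using that by (auto simp: B_def J_def)
      then show ?thesis by (simp add: B3_def)
    qed
  qed (auto simp: B_def B0_def B1_def B2_def not_less)
qed

subsection \<open>Weighted least squares\<close>

lemma polys_iff: "p \<in> polys n \<longleftrightarrow> deg_less n p"
  by (simp add: polys_def deg_less_iff)

lemma poly_fun_add: "poly_fun (p + q) x = poly_fun p x + poly_fun q x"
  and poly_fun_diff: "poly_fun (p - q) x = poly_fun p x - poly_fun q x"
  and poly_fun_smult: "poly_fun (smult c p) x = c * poly_fun p x"
  by (simp_all add: poly_fun_def)

text \<open>Only a semi-inner product: weights may be zero, and a nonzero polynomial may vanish at
  all samples.\<close>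

definition wdot :: "nat \<Rightarrow> (nat \<Rightarrow> real) \<Rightarrow> (nat \<Rightarrow> complex) \<Rightarrow> (nat \<Rightarrow> complex) \<Rightarrow> complex" where
  "wdot m u a b = (\<Sum>i<m. of_real (u i) * a i * cnj (b i))"

definition wsq :: "nat \<Rightarrow> (nat \<Rightarrow> real) \<Rightarrow> (nat \<Rightarrow> complex) \<Rightarrow> real" where
  "wsq m u a = (\<Sum>i<m. u i * (cmod (a i))\<^sup>2)"

lemma wdot_left_diff: "wdot m u (\<lambda>i. a i - b i) d = wdot m u a d - wdot m u b d"
  by (simp add: wdot_def algebra_simps sum_subtractf)

lemma wdot_left_mult: "wdot m u (\<lambda>i. c * a i) d = c * wdot m u a d"
  by (simp add: wdot_def sum_distrib_left mult_ac)

lemma wdot_right_add: "wdot m u d (\<lambda>i. a i + b i) = wdot m u d a + wdot m u d b"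
  by (simp add: wdot_def algebra_simps sum.distrib)

lemma wdot_right_mult: "wdot m u d (\<lambda>i. c * a i) = cnj c * wdot m u d a"
  by (simp add: wdot_def sum_distrib_left mult_ac)

lemma wdot_self: "wdot m u a a = of_real (wsq m u a)"
  by (simp add: wdot_def wsq_def complex_norm_square mult.assoc del: of_real_power flip: of_real_power)

lemma wsq_nonneg: "(\<And>i. i < m \<Longrightarrow> 0 \<le> u i) \<Longrightarrow> 0 \<le> wsq m u a"
  by (auto simp: wsq_def intro!: sum_nonneg)

text \<open>The degenerate case of Cauchy-Schwarz: a null vector vanishes wherever the weight is
  positive.\<close>

lemma wdot_eq_0_if_wsq_eq_0:
  assumes u: "\<And>i. i < m \<Longrightarrow> 0 \<le> u i" and "wsq m u a = 0"
  shows "wdot m u b a = 0"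
proof -
  have "u i * (cmod (a i))\<^sup>2 = 0" if "i < m" for i
    using assms(2) u that unfolding wsq_def by (subst (asm) sum_nonneg_eq_0_iff) auto
  then have "\<forall>i\<in>{..<m}. of_real (u i) * b i * cnj (a i) = 0"
    by fastforce
  then show ?thesis unfolding wdot_def by (rule sum.neutral)
qed

lemma wsq_add: "wsq m u (\<lambda>i. a i + b i) = wsq m u a + wsq m u b + 2 * Re (wdot m u a b)"
proof -
  have "(cmod (z + w))\<^sup>2 = (cmod z)\<^sup>2 + (cmod w)\<^sup>2 + 2 * Re (z * cnj w)" for z w
    by (simp add: cmod_power2) (simp add: power2_eq_square algebra_simps)
  then show ?thesis
    by (simp add: wsq_def wdot_def sum.distrib sum_distrib_left distrib_left mult_ac)
qed

text \<open>Gram-Schmidt as in \<open>pint_projection\<close>, now for a form that may be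
  degenerate; a null direction is orthogonal to everything and calls for no correction.\<close>

lemma discrete_projection:
  assumes u: "\<And>i. i < m \<Longrightarrow> 0 \<le> u i"
  shows "\<exists>q. deg_less n q \<and>
    (\<forall>r. deg_less n r \<longrightarrow> wdot m u (\<lambda>i. y i - poly_fun q (x i)) (\<lambda>i. poly_fun r (x i)) = 0)"
proof (induction n arbitrary: y)
  case 0
  then show ?case by (auto simp: wdot_def poly_fun_def)
next
  case (Suc n)
  define E where "E q = (\<lambda>i. poly_fun q (x i))" for q
  obtain q0 where q0: "deg_less n q0"
      "\<And>r. deg_less n r \<Longrightarrow> wdot m u (\<lambda>i. y i - E q0 i) (E r) = 0"
    using Suc.IH[of y] unfolding E_def by blast
  obtain q1 where q1: "deg_less n q1"
      "\<And>r. deg_less n r \<Longrightarrow> wdot m u (\<lambda>i. E (monom 1 n) i - E q1 i) (E r) = 0"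
    using Suc.IH[of "E (monom 1 n)"] unfolding E_def by blast
  define v where "v = monom 1 n - q1"
  have v: "deg_less (Suc n) v" "coeff v n = 1"
    using q1(1) by (auto simp: v_def deg_less_def)
  have Ev: "E v = (\<lambda>i. E (monom 1 n) i - E q1 i)"
    by (simp add: v_def E_def poly_fun_diff)
  \<comment> \<open>If \<open>E v\<close> is null, division by zero gives c = 0, and
    \<open>wdot_eq_0_if_wsq_eq_0\<close> supplies the orthogonality.\<close>
  define c where "c = wdot m u (\<lambda>i. y i - E q0 i) (E v) / of_real (wsq m u (E v))"
  define q where "q = q0 + smult c v"
  have split: "(\<lambda>i. y i - E q i) = (\<lambda>i. (y i - E q0 i) - c * E v i)"
    by (simp add: q_def E_def poly_fun_add poly_fun_smult fun_eq_iff)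
  have res: "wdot m u (\<lambda>i. y i - E q i) d = wdot m u (\<lambda>i. y i - E q0 i) d - c * wdot m u (E v) d" for d
    unfolding split by (simp only: wdot_left_diff[of _ _ _ "\<lambda>i. c * E v i"] wdot_left_mult)
  have orth_v: "wdot m u (\<lambda>i. y i - E q i) (E v) = 0"
  proof (cases "wsq m u (E v) = 0")
    case True
    then show ?thesis using u wdot_eq_0_if_wsq_eq_0 by blast
  next
    case False
    then show ?thesis by (simp add: res wdot_self c_def)
  qed
  have "wdot m u (\<lambda>i. y i - E q i) (E r) = 0" if r: "deg_less (Suc n) r" for r
  proof -
    define s where "s = r - smult (coeff r n) v"
    have s: "deg_less n s" unfolding s_def by (rule deg_less_Suc_decompose[OF r v])
    have "E r = (\<lambda>i. E s i + coeff r n * E v i)"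
      by (simp add: s_def E_def poly_fun_diff poly_fun_smult fun_eq_iff)
    moreover have "wdot m u (\<lambda>i. y i - E q i) (E s) = 0"
      using q0(2)[OF s] q1(2)[OF s] by (simp add: res Ev)
    ultimately show ?thesis using orth_v by (simp add: wdot_right_add wdot_right_mult)
  qed
  moreover have "deg_less (Suc n) q"
    using q0(1) v(1) by (simp add: q_def deg_less_add deg_less_smult deg_less_Suc)
  ultimately show ?case unfolding E_def by blast
qed

text \<open>Pythagoras shows that the projection \<open>q\<close> is a minimiser and, with
  definiteness, the only one. The second claim is the contraction property of the projection. The
  factor 1/m is absorbed into \<open>u\<close>.\<close>

lemma wls_estimator_projection:
  assumes w: "\<And>i. i < m \<Longrightarrow> 0 \<le> w (x i)"
  defines "u \<equiv> \<lambda>i. w (x i) / real m"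
  assumes definite: "\<And>r. deg_less n r \<Longrightarrow> wsq m u (\<lambda>i. poly_fun r (x i)) = 0 \<Longrightarrow> r = 0"
  shows "\<exists>!p. is_wls_estimator n w m x y p"
    and "\<And>p r. is_wls_estimator n w m x y p \<Longrightarrow> deg_less n r \<Longrightarrow>
      wsq m u (\<lambda>i. poly_fun (p - r) (x i)) \<le> wsq m u (\<lambda>i. y i - poly_fun r (x i))"
proof -
  have u: "0 \<le> u i" if "i < m" for i using w that by (simp add: u_def)
  obtain q where q: "deg_less n q"
    and orth: "\<And>r. deg_less n r \<Longrightarrow> wdot m u (\<lambda>i. y i - poly_fun q (x i)) (\<lambda>i. poly_fun r (x i)) = 0"
    using discrete_projection[of m u n y x] u by blast
  have pyth: "wsq m u (\<lambda>i. y i - poly_fun r (x i)) =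
      wsq m u (\<lambda>i. y i - poly_fun q (x i)) + wsq m u (\<lambda>i. poly_fun (q - r) (x i))"
    if r: "deg_less n r" for r
    using wsq_add[of m u "\<lambda>i. y i - poly_fun q (x i)" "\<lambda>i. poly_fun (q - r) (x i)"]
      orth[OF deg_less_diff[OF q r]]
    by (simp add: poly_fun_diff)
  have obj: "1 / real m * (\<Sum>i<m. w (x i) * (cmod (y i - poly_fun r (x i)))\<^sup>2) =
      wsq m u (\<lambda>i. y i - poly_fun r (x i))" for r
    by (simp add: wsq_def u_def sum_divide_distrib)
  have iff: "is_wls_estimator n w m x y p \<longleftrightarrow> p = q" for p
  proof
    assume p: "is_wls_estimator n w m x y p"
    then have "deg_less n p" by (simp add: is_wls_estimator_def is_arg_min_def polys_iff)
    moreover have "wsq m u (\<lambda>i. y i - poly_fun p (x i)) \<le> wsq m u (\<lambda>i. y i - poly_fun q (x i))"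
      using p q unfolding is_wls_estimator_def is_arg_min_def polys_iff obj by (auto simp: not_less)
    ultimately have "wsq m u (\<lambda>i. poly_fun (q - p) (x i)) = 0"
      using pyth wsq_nonneg[of m u "\<lambda>i. poly_fun (q - p) (x i)"] u by force
    then show "p = q"
      using definite[OF deg_less_diff[OF q \<open>deg_less n p\<close>]] by simp
  next
    assume "p = q"
    have "wsq m u (\<lambda>i. y i - poly_fun q (x i)) \<le> wsq m u (\<lambda>i. y i - poly_fun r (x i))"
      if "deg_less n r" for r
      using pyth[OF that] wsq_nonneg[of m u "\<lambda>i. poly_fun (q - r) (x i)"] u by simp
    then show "is_wls_estimator n w m x y p"
      using q \<open>p = q\<close> unfolding is_wls_estimator_def is_arg_min_def polys_iff obj
      by (auto simp: not_less)
  qed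
  show "\<exists>!p. is_wls_estimator n w m x y p" by (simp add: iff)
  show "wsq m u (\<lambda>i. poly_fun (p - r) (x i)) \<le> wsq m u (\<lambda>i. y i - poly_fun r (x i))"
    if "is_wls_estimator n w m x y p" "deg_less n r" for p r
    using that pyth[of r] wsq_nonneg[of m u "\<lambda>i. y i - poly_fun q (x i)"] u by (simp add: iff)
qed

section \<open>Complex polynomials through their real and imaginary parts\<close>

abbreviation re_poly :: "complex poly \<Rightarrow> real poly" where "re_poly \<equiv> map_poly Re"
abbreviation im_poly :: "complex poly \<Rightarrow> real poly" where "im_poly \<equiv> map_poly Im"

lemma poly_re_poly: "poly (re_poly p) x = Re (poly_fun p x)"
  by (induction p) (simp_all add: poly_fun_def map_poly_pCons)

lemma poly_im_poly: "poly (im_poly p) x = Im (poly_fun p x)"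
  by (induction p) (simp_all add: poly_fun_def map_poly_pCons)

text \<open>The squared L^2 norm for Lebesgue measure on [-1, 1], twice the one for
  \<open>rho\<close>. Real and imaginary parts can be treated separately because sample points and
  weights are real.\<close>

definition cpint :: "complex poly \<Rightarrow> real" where
  "cpint p = pint (re_poly p * re_poly p) + pint (im_poly p * im_poly p)"

lemma cmod_poly_fun: "(cmod (poly_fun p x))\<^sup>2 = (poly (re_poly p) x)\<^sup>2 + (poly (im_poly p) x)\<^sup>2"
  by (simp add: poly_re_poly poly_im_poly cmod_power2)

lemma deg_less_re_im:
  assumes "deg_less n p" shows "deg_less n (re_poly p)" "deg_less n (im_poly p)"
  using assms by (simp_all add: deg_less_def coeff_map_poly)

lemma cpint_nonneg: "0 \<le> cpint p"
  by (simp add: cpint_def pint_square_nonneg)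

lemma cpint_eq_0: assumes "cpint p = 0" shows "p = 0"
proof -
  have "re_poly p = 0 \<and> im_poly p = 0"
    using assms pint_square_nonneg[of "re_poly p"] pint_square_nonneg[of "im_poly p"]
    by (simp add: cpint_def add_nonneg_eq_0_iff pint_square_eq_0_iff)
  then have "Re (coeff p i) = 0 \<and> Im (coeff p i) = 0" for i
    using coeff_map_poly[of Re p i] coeff_map_poly[of Im p i] by simp
  then show ?thesis by (intro poly_eqI) (simp add: complex_eq_iff)
qed

lemma complex_nikolskii:
  assumes "deg_less n p" "x \<in> D"
  shows "(cmod (poly_fun p x))\<^sup>2 \<le> 10 * (real n)\<^sup>2 * cpint p"
  using nikolskii[OF deg_less_re_im(1)[OF assms(1)], of x]
    nikolskii[OF deg_less_re_im(2)[OF assms(1)], of x] assms(2)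
  by (simp add: cmod_poly_fun cpint_def D_def distrib_left)

lemma poly_fun_measurable [measurable]: "poly_fun p \<in> borel_measurable borel"
  unfolding poly_fun_def[abs_def]
  by (intro borel_measurable_continuous_onI continuous_intros)

lemma integral_poly_fun: "(\<integral>x. (cmod (poly_fun p x))\<^sup>2 \<partial>rho) = cpint p / 2"
proof -
  have "(\<integral>\<^sup>+x. ennreal ((cmod (poly_fun p x))\<^sup>2) \<partial>rho) =
      (\<integral>\<^sup>+x. ennreal (poly (re_poly p * re_poly p + im_poly p * im_poly p) x) \<partial>rho)"
  proof (rule nn_integral_cong)
    fix x
    have "(cmod (poly_fun p x))\<^sup>2 = poly (re_poly p * re_poly p + im_poly p * im_poly p) x"
      unfolding cmod_poly_fun by (simp add: power2_eq_square)
    then show "ennreal ((cmod (poly_fun p x))\<^sup>2) =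
        ennreal (poly (re_poly p * re_poly p + im_poly p * im_poly p) x)" by (rule arg_cong)
  qed
  also have "\<dots> = ennreal (cpint p / 2)"
    by (subst nn_integral_poly_rho) (simp_all add: cpint_def pint_add)
  finally show ?thesis
    by (subst integral_eq_nn_integral) (auto simp: cpint_nonneg cong: measurable_cong_sets)
qed

lemma integrable_poly_fun: "integrable rho (\<lambda>x. (cmod (poly_fun p x))\<^sup>2)"
proof -
  interpret rho: prob_space rho by (rule prob_space_rho)
  have p: "deg_less (Suc (degree p)) p" by (simp add: deg_less_iff)
  show ?thesis
    using complex_nikolskii[OF p]
    by (intro rho.integrable_const_bound[of _ "10 * (real (Suc (degree p)))\<^sup>2 * cpint p"] AE_I2)
      (auto cong: measurable_cong_sets)
qed

lemma complex_frame:
  assumes p: "deg_less n p" and n: "n > 0" and N: "N = 10 * n"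
    and u: "\<And>i. i < m \<Longrightarrow> 0 \<le> u i"
    and cells: "\<And>j s. j \<in> {1..<N} \<Longrightarrow> s \<in> {1, -1} \<Longrightarrow>
      node N j - node N (Suc j) \<le> 4 * (\<Sum>i<m. u i * indicator (cell N j) (s * x i))"
  shows "cpint p \<le> 16 * wsq m u (\<lambda>i. poly_fun p (x i))"
proof -
  have "pint (q * q) \<le> 16 * (\<Sum>i<m. u i * (poly q (x i))\<^sup>2)" if "deg_less n q" for q
    using cells[of _ 1] cells[of _ "-1"] by (intro frame[OF that n N u]) auto
  from this[OF deg_less_re_im(1)[OF p]] this[OF deg_less_re_im(2)[OF p]]
  show ?thesis
    by (simp add: cpint_def wsq_def cmod_poly_fun distrib_left sum.distrib)
qed

lemma L2_norm_nonneg: "0 \<le> L2_norm M f"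
  by (simp add: L2_norm_def)

lemma L2_norm_square: "(L2_norm M f)\<^sup>2 = (\<integral>x. (cmod (f x))\<^sup>2 \<partial>M)"
  by (simp add: L2_norm_def)

lemma cmod_add_square_le: "(cmod (z + w))\<^sup>2 \<le> 2 * (cmod z)\<^sup>2 + 2 * (cmod w)\<^sup>2"
proof -
  have "(cmod (z + w))\<^sup>2 \<le> (cmod z + cmod w)\<^sup>2"
    by (intro power_mono norm_triangle_ineq) simp
  also have "\<dots> \<le> 2 * (cmod z)\<^sup>2 + 2 * (cmod w)\<^sup>2"
    using zero_le_power2[of "cmod z - cmod w"] by (simp add: power2_eq_square algebra_simps)
  finally show ?thesis .
qed

text \<open>Every single weight is at most the total weight. This crude step keeps the event
  independent of the noise, which may even be chosen after the samples.\<close>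

lemma wsq_le:
  assumes u: "\<And>i. i < m \<Longrightarrow> 0 \<le> u i" and "(\<Sum>i<m. u i) \<le> B"
  shows "wsq m u e \<le> B * (L2_set (\<lambda>i. cmod (e i)) {..<m})\<^sup>2"
proof -
  have "u i \<le> B" if "i < m" for i
    using member_le_sum[of i "{..<m}" u] u that assms(2) by auto
  then have "wsq m u e \<le> (\<Sum>i<m. B * (cmod (e i))\<^sup>2)"
    unfolding wsq_def by (intro sum_mono mult_right_mono) auto
  also have "\<dots> = B * (L2_set (\<lambda>i. cmod (e i)) {..<m})\<^sup>2"
    by (simp add: L2_set_def sum_nonneg sum_distrib_left)
  finally show ?thesis .
qed

text \<open>The deterministic part: f - p is split into the residual f - q and the polynomial h = p
  - q. The discrete norm of h is bounded by that of residual plus noise, and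
  \<open>complex_frame\<close> returns to the continuous norm.\<close>

lemma wls_error:
  fixes x :: "nat \<Rightarrow> real" and e :: "nat \<Rightarrow> complex"
  assumes w: "\<And>i. i < m \<Longrightarrow> 0 \<le> w (x i)" and m: "0 < m" and n: "0 < n"
    and \<epsilon>: "0 < \<epsilon>" "\<epsilon> < 1"
    and f: "f \<in> borel_measurable rho" and intf: "integrable rho (\<lambda>t. (cmod (f t - poly_fun q t))\<^sup>2)"
    and q: "deg_less n q"
  defines "g \<equiv> \<lambda>t. (cmod (f t - poly_fun q t))\<^sup>2"
    and "\<eta> \<equiv> L2_norm rho (\<lambda>t. f t - poly_fun q t)"
    and "\<nu> \<equiv> L2_set (\<lambda>i. cmod (e i)) {..<m}"
  assumes data: "(\<Sum>i<m. w (x i) * g (x i)) \<le> 4 / \<epsilon> * (real m * \<eta>\<^sup>2)"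
    and total: "(\<Sum>i<m. w (x i)) \<le> 4 / \<epsilon> * real m"
    and cells: "\<And>j s. j \<in> {1..<10 * n} \<Longrightarrow> s \<in> {1, -1} \<Longrightarrow>
      real m * (node (10 * n) j - node (10 * n) (Suc j))
        \<le> 4 * (\<Sum>i<m. w (x i) * indicator (cell (10 * n) j) (s * x i))"
  shows "\<exists>!p. is_wls_estimator n w m x (\<lambda>i. f (x i) + e i) p"
    and "\<And>p. is_wls_estimator n w m x (\<lambda>i. f (x i) + e i) p \<Longrightarrow>
      L2_norm rho (\<lambda>t. f t - poly_fun p t) \<le> 36 * (real n / sqrt \<epsilon> * (\<eta> + \<nu>)) \<and>
      Linf_norm rho (\<lambda>t. f t - poly_fun p t) \<le>
        ennreal 36 * (Linf_norm rho (\<lambda>t. f t - poly_fun q t) + ennreal (real n / sqrt \<epsilon> * (\<eta> + \<nu>)))"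
proof -
  define u where "u = (\<lambda>i. w (x i) / real m)"
  have u: "0 \<le> u i" if "i < m" for i using w that by (simp add: u_def)
  have cells': "node (10 * n) j - node (10 * n) (Suc j) \<le>
      4 * (\<Sum>i<m. u i * indicator (cell (10 * n) j) (s * x i))"
    if "j \<in> {1..<10 * n}" "s \<in> {1, -1}" for j s
  proof -
    have "real m * (\<Sum>i<m. u i * indicator (cell (10 * n) j) (s * x i)) =
        (\<Sum>i<m. w (x i) * indicator (cell (10 * n) j) (s * x i))"
      unfolding sum_distrib_left using m by (intro sum.cong) (auto simp: u_def)
    then have "real m * (node (10 * n) j - node (10 * n) (Suc j)) \<le>
        real m * (4 * (\<Sum>i<m. u i * indicator (cell (10 * n) j) (s * x i)))"
      using cells[OF that] by (simp only: mult.left_commute[of "real m" 4])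
    then show ?thesis using m by simp
  qed
  have frame: "cpint r \<le> 16 * wsq m u (\<lambda>i. poly_fun r (x i))" if "deg_less n r" for r
    by (rule complex_frame[OF that n refl u cells'])
  have definite: "r = 0" if "deg_less n r" "wsq m u (\<lambda>i. poly_fun r (x i)) = 0" for r
    using frame[OF that(1)] that(2) cpint_nonneg[of r] by (intro cpint_eq_0) simp
  note wls = wls_estimator_projection[where m = m and w = w and x = x and n = n
      and y = "\<lambda>i. f (x i) + e i", folded u_def, OF w definite]
  show "\<exists>!p. is_wls_estimator n w m x (\<lambda>i. f (x i) + e i) p" by (rule wls(1))
  have \<eta>\<nu>: "0 \<le> \<eta>" "0 \<le> \<nu>" by (simp_all add: \<eta>_def \<nu>_def L2_norm_nonneg L2_set_nonneg)
  fix p assume p: "is_wls_estimator n w m x (\<lambda>i. f (x i) + e i) p"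
  then have "deg_less n p" by (simp add: is_wls_estimator_def is_arg_min_def polys_iff)
  define h where "h = p - q"
  have h: "deg_less n h" unfolding h_def by (rule deg_less_diff) fact+
  define T where "T = (\<eta> + \<nu>)\<^sup>2 / \<epsilon>"
  have "wsq m u (\<lambda>i. poly_fun h (x i)) \<le> wsq m u (\<lambda>i. f (x i) + e i - poly_fun q (x i))"
    unfolding h_def by (rule wls(2)[OF _ _ _ p q])
  also have "\<dots> \<le> (\<Sum>i<m. u i * (2 * g (x i) + 2 * (cmod (e i))\<^sup>2))"
    unfolding wsq_def
  proof (intro sum_mono mult_left_mono)
    fix i
    show "(cmod (f (x i) + e i - poly_fun q (x i)))\<^sup>2 \<le> 2 * g (x i) + 2 * (cmod (e i))\<^sup>2"
      using cmod_add_square_le[of "f (x i) - poly_fun q (x i)" "e i"]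
      by (simp add: g_def algebra_simps)
  qed (use u in simp)
  also have "\<dots> = 2 * (\<Sum>i<m. u i * g (x i)) + 2 * wsq m u e"
    by (simp add: wsq_def sum_distrib_left sum.distrib algebra_simps)
  also have "(\<Sum>i<m. u i * g (x i)) \<le> 4 / \<epsilon> * \<eta>\<^sup>2"
  proof -
    have "(\<Sum>i<m. u i * g (x i)) = (\<Sum>i<m. w (x i) * g (x i)) / real m"
      by (simp add: u_def sum_divide_distrib)
    also have "\<dots> \<le> 4 / \<epsilon> * \<eta>\<^sup>2" using data m by (simp add: pos_divide_le_eq mult_ac)
    finally show ?thesis .
  qed
  also have "wsq m u e \<le> 4 / \<epsilon> * \<nu>\<^sup>2"
    unfolding \<nu>_def
  proof (rule wsq_le[OF u])
    have "(\<Sum>i<m. u i) = (\<Sum>i<m. w (x i)) / real m" by (simp add: u_def sum_divide_distrib)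
    also have "\<dots> \<le> 4 / \<epsilon>" using total m by (simp add: pos_divide_le_eq)
    finally show "(\<Sum>i<m. u i) \<le> 4 / \<epsilon>" .
  qed
  finally have "wsq m u (\<lambda>i. poly_fun h (x i)) \<le> 8 * ((\<eta>\<^sup>2 + \<nu>\<^sup>2) / \<epsilon>)"
    by (simp add: add_divide_distrib)
  also have "\<dots> \<le> 8 * T"
    unfolding T_def using \<eta>\<nu> \<epsilon> by (intro mult_left_mono divide_right_mono) (auto simp: power2_sum)
  finally have h_le: "cpint h \<le> 128 * T" using frame[OF h] by simp
  have f_p: "f t - poly_fun p t = (f t - poly_fun q t) + - poly_fun h t" for t
    by (simp add: h_def poly_fun_diff)

  \<comment> \<open>36^2 = 1296 dominates both requirements: 10 * 128 n^2 T for the uniform norm of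
    h, by Nikolskii and \<open>h_le\<close>, and 2 T + 128 T for the L^2 error.\<close>
  define K where "K = 36 * (real n / sqrt \<epsilon> * (\<eta> + \<nu>))"
  have K: "0 \<le> K" using \<eta>\<nu> \<epsilon> by (simp add: K_def)
  have K2: "K\<^sup>2 = 1296 * (real n)\<^sup>2 * T"
    using \<epsilon> by (simp add: K_def T_def power_mult_distrib power_divide)
  have T: "0 \<le> T" using \<epsilon> by (simp add: T_def)
  have n1: "1 \<le> (real n)\<^sup>2" using n by (simp add: one_le_power)
  have "(L2_norm rho (\<lambda>t. f t - poly_fun p t))\<^sup>2 \<le> (\<integral>t. 2 * g t + 2 * (cmod (poly_fun h t))\<^sup>2 \<partial>rho)"
    unfolding L2_norm_square
  proof (rule integral_mono')
    show "integrable rho (\<lambda>t. 2 * g t + 2 * (cmod (poly_fun h t))\<^sup>2)"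
      using intf integrable_poly_fun[of h] by (simp add: g_def)
    show "(cmod (f t - poly_fun p t))\<^sup>2 \<le> 2 * g t + 2 * (cmod (poly_fun h t))\<^sup>2" for t
      using cmod_add_square_le[of "f t - poly_fun q t" "- poly_fun h t"] by (simp add: f_p g_def)
  qed (simp add: g_def)
  also have "\<dots> = 2 * \<eta>\<^sup>2 + cpint h"
    using intf integrable_poly_fun[of h]
    by (simp add: g_def \<eta>_def L2_norm_square integral_poly_fun)
  finally have L2': "(L2_norm rho (\<lambda>t. f t - poly_fun p t))\<^sup>2 \<le> 2 * \<eta>\<^sup>2 + cpint h" .
  have "\<eta>\<^sup>2 \<le> T"
  proof -
    have "\<eta>\<^sup>2 \<le> (\<eta> + \<nu>)\<^sup>2" using \<eta>\<nu> by (intro power_mono) auto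
    also have "\<dots> \<le> T" unfolding T_def using \<epsilon> by (simp add: pos_le_divide_eq mult_left_le)
    finally show ?thesis .
  qed
  then have "2 * \<eta>\<^sup>2 + cpint h \<le> 1296 * 1 * T" using h_le T by simp
  also have "\<dots> \<le> K\<^sup>2" unfolding K2 using n1 T by (intro mult_right_mono mult_left_mono) auto
  finally have "(L2_norm rho (\<lambda>t. f t - poly_fun p t))\<^sup>2 \<le> K\<^sup>2" using L2' by linarith
  then have L2: "L2_norm rho (\<lambda>t. f t - poly_fun p t) \<le> K" using K by (rule power2_le_imp_le)
  have hK: "cmod (poly_fun h t) \<le> K" if "t \<in> D" for t
  proof (rule power2_le_imp_le[OF _ K])
    have "(cmod (poly_fun h t))\<^sup>2 \<le> 10 * (real n)\<^sup>2 * cpint h"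
      by (rule complex_nikolskii[OF h that])
    also have "\<dots> \<le> 10 * (real n)\<^sup>2 * (128 * T)"
      by (rule mult_left_mono[OF h_le]) simp
    also have "\<dots> \<le> K\<^sup>2" unfolding K2 using T by (simp add: mult_right_mono)
    finally show "(cmod (poly_fun h t))\<^sup>2 \<le> K\<^sup>2" .
  qed
  let ?I = "Linf_norm rho (\<lambda>t. f t - poly_fun q t)"
  have "Linf_norm rho (\<lambda>t. f t - poly_fun p t) \<le> ?I + ennreal K"
    unfolding Linf_norm_def
  proof (rule esssup_I)
    show "(\<lambda>t. ennreal (cmod (f t - poly_fun p t))) \<in> borel_measurable rho"
      using f by (intro measurable_compose[OF _ measurable_ennreal] borel_measurable_norm
          borel_measurable_diff) (auto cong: measurable_cong_sets)
    have "AE t in rho. ennreal (cmod (f t - poly_fun q t)) \<le>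
        esssup rho (\<lambda>t. ennreal (cmod (f t - poly_fun q t)))" by (rule esssup_AE)
    moreover have "AE t in rho. t \<in> D" by (rule AE_I2) simp
    ultimately show "AE t in rho. ennreal (cmod (f t - poly_fun p t)) \<le>
        esssup rho (\<lambda>t. ennreal (cmod (f t - poly_fun q t))) + ennreal K"
    proof eventually_elim
      case (elim t)
      have "cmod (f t - poly_fun p t) \<le> cmod (f t - poly_fun q t) + K"
        using norm_triangle_ineq[of "f t - poly_fun q t" "- poly_fun h t"] hK[OF elim(2)]
        by (simp add: f_p)
      then have "ennreal (cmod (f t - poly_fun p t)) \<le> ennreal (cmod (f t - poly_fun q t)) + ennreal K"
        using K by (simp add: ennreal_leI flip: ennreal_plus)
      also have "\<dots> \<le> esssup rho (\<lambda>t. ennreal (cmod (f t - poly_fun q t))) + ennreal K"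
        using elim(1) by (rule add_right_mono)
      finally show ?case .
    qed
  qed
  also have "\<dots> \<le> ennreal 36 * ?I + ennreal K"
  proof (rule add_right_mono)
    have "1 * ?I \<le> ennreal 36 * ?I" by (rule mult_right_mono) simp_all
    then show "?I \<le> ennreal 36 * ?I" by simp
  qed
  also have "\<dots> = ennreal 36 * (?I + ennreal (real n / sqrt \<epsilon> * (\<eta> + \<nu>)))"
    using \<eta>\<nu> \<epsilon> unfolding K_def by (subst ennreal_mult) (auto simp: distrib_left)
  finally show "L2_norm rho (\<lambda>t. f t - poly_fun p t) \<le> 36 * (real n / sqrt \<epsilon> * (\<eta> + \<nu>)) \<and>
      Linf_norm rho (\<lambda>t. f t - poly_fun p t) \<le> ennreal 36 * (?I + ennreal (real n / sqrt \<epsilon> * (\<eta> + \<nu>)))"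
    using L2 unfolding K_def by simp
qed

subsection \<open>Sample size and cost\<close>

text \<open>The maximum with 1 secures m >= n; the other term is the demand of
  \<open>good_samples\<close>.\<close>

definition sample_const :: "real \<Rightarrow> real" where
  "sample_const \<beta> = max 1 (160 * jacobi_mass \<beta> * 10 powr (2 * \<beta> + 2))"

definition sample_size :: "real \<Rightarrow> nat \<Rightarrow> real \<Rightarrow> nat" where
  "sample_size \<beta> n \<epsilon> =
    nat \<lceil>sample_const \<beta> * real n powr (2 * \<beta> + 2) * ln (3 * real n / \<epsilon>)\<rceil>"

text \<open>Since 3 exceeds e, the logarithm can absorb additive constants such as the rounding of
  the sample size.\<close>

lemma ln_ge_1:
  assumes "1 \<le> n" "0 < \<epsilon>" "\<epsilon> < 1" shows "1 \<le> ln (3 * real n / \<epsilon>)"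
proof -
  have "exp 1 \<le> (3::real)" by (rule exp_le)
  also have "3 \<le> 3 * real n / \<epsilon>"
    using assms by (simp add: pos_le_divide_eq mult_mono)
  finally show ?thesis using assms by (subst ln_ge_iff) auto
qed

lemma sample_size_bounds:
  assumes \<beta>: "-1/2 \<le> \<beta>" and n: "1 \<le> n" and \<epsilon>: "0 < \<epsilon>" "\<epsilon> < 1"
  shows "n \<le> sample_size \<beta> n \<epsilon>"
    and "160 * jacobi_mass \<beta> * 10 powr (2 * \<beta> + 2) * real n powr (2 * \<beta> + 2) * ln (3 * real n / \<epsilon>)
      \<le> real (sample_size \<beta> n \<epsilon>)"
    and "real (sample_size \<beta> n \<epsilon>) \<le>
      (sample_const \<beta> + 1) * (real n powr (2 * \<beta> + 2) * ln (3 * real n / \<epsilon>))"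
proof -
  define X L where "X = real n powr (2 * \<beta> + 2)" and "L = ln (3 * real n / \<epsilon>)"
  have L: "1 \<le> L" unfolding L_def by (rule ln_ge_1) fact+
  \<comment> \<open>Here beta >= -1/2 enters: 2 beta + 2 is at least 1.\<close>
  have "real n powr 1 \<le> X" unfolding X_def using n \<beta> by (intro powr_mono) auto
  then have X: "real n \<le> X" by simp
  then have X1: "1 \<le> X" using n by simp
  have XL: "X \<le> X * L" using X1 L by simp
  have M: "1 \<le> sample_const \<beta>" by (simp add: sample_const_def)
  define Y where "Y = sample_const \<beta> * (X * L)"
  have Y: "X * L \<le> Y" unfolding Y_def using M X1 L by simp
  have m: "sample_size \<beta> n \<epsilon> = nat \<lceil>Y\<rceil>"
    by (simp add: sample_size_def Y_def X_def L_def mult.assoc)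
  have Ym: "Y \<le> real (nat \<lceil>Y\<rceil>)" by (rule real_nat_ceiling_ge)
  then show "n \<le> sample_size \<beta> n \<epsilon>" using X XL Y unfolding m by linarith
  have "160 * jacobi_mass \<beta> * 10 powr (2 * \<beta> + 2) * (X * L) \<le> Y"
    unfolding Y_def using X1 L by (intro mult_right_mono) (auto simp: sample_const_def)
  then show "160 * jacobi_mass \<beta> * 10 powr (2 * \<beta> + 2) * real n powr (2 * \<beta> + 2) * ln (3 * real n / \<epsilon>)
      \<le> real (sample_size \<beta> n \<epsilon>)"
    unfolding m X_def[symmetric] L_def[symmetric] mult.assoc using Ym by linarith
  \<comment> \<open>Rounding up costs at most 1, which X * L >= 1 absorbs; hence the constant
    \<open>sample_const \<beta> + 1\<close>.\<close>
  have "real (nat \<lceil>Y\<rceil>) \<le> Y + 1" using Y XL X1 by linarith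
  also have "\<dots> \<le> Y + X * L" using XL X1 by linarith
  finally show "real (sample_size \<beta> n \<epsilon>) \<le>
      (sample_const \<beta> + 1) * (real n powr (2 * \<beta> + 2) * ln (3 * real n / \<epsilon>))"
    unfolding m by (simp add: Y_def X_def L_def distrib_right)
qed

text \<open>The bound on the number of samples per unit of n^(2 beta + 2) ln (3n / eps), times the
  bound on the mean cost of one sample.\<close>

definition cost_const :: "real \<Rightarrow> real \<Rightarrow> real \<Rightarrow> real" where
  "cost_const \<alpha> \<beta> K = (sample_const \<beta> + 1) * (K * jacobi_mass (\<beta> - \<alpha>) / jacobi_mass \<beta>)"

lemma cost_const_pos:
  assumes "-1 < \<beta>" "-1 < \<beta> - \<alpha>" "0 < K" shows "0 < cost_const \<alpha> \<beta> K"
  unfolding cost_const_def using jacobi_mass_pos[OF assms(1)] jacobi_mass_pos[OF assms(2)] assms(3)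
  by (intro mult_pos_pos divide_pos_pos) (auto simp: sample_const_def)

lemma expected_cost_le:
  assumes \<beta>: "-1/2 \<le> \<beta>" "-1 < \<beta> - \<alpha>" and n: "1 \<le> n" and \<epsilon>: "0 < \<epsilon>" "\<epsilon> < 1" and K: "0 < K"
    and c: "\<And>x. x \<in> D \<Longrightarrow> c x \<le> K * (1 - x\<^sup>2) powr (- \<alpha>)"
  shows "expected_cost c (sampling_measure \<beta>) (sample_size \<beta> n \<epsilon>)
    \<le> ennreal (cost_const \<alpha> \<beta> K * (real n powr (2 * \<beta> + 2) * ln (3 * real n / \<epsilon>)))"
proof -
  define m where "m = sample_size \<beta> n \<epsilon>"
  define V where "V = K * jacobi_mass (\<beta> - \<alpha>) / jacobi_mass \<beta>"
  have V: "0 \<le> V"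
    using jacobi_mass_pos[of \<beta>] jacobi_mass_pos[of "\<beta> - \<alpha>"] \<beta> K by (simp add: V_def)
  have "(\<integral>\<^sup>+x. ennreal (c x) \<partial>sampling_measure \<beta>) \<le>
      (\<integral>\<^sup>+x. ennreal (K * jacobi (- \<alpha>) x) \<partial>sampling_measure \<beta>)"
    using c by (intro nn_integral_mono ennreal_leI) (simp add: jacobi_def)
  also have "\<dots> = ennreal V"
    using nn_integral_sampling_jacobi[of \<beta> "-\<alpha>" K] \<beta> K by (simp add: V_def)
  finally have "expected_cost c (sampling_measure \<beta>) m \<le> of_nat m * ennreal V"
    unfolding expected_cost_def by (rule mult_left_mono) simp
  also have "\<dots> = ennreal (real m * V)"
    using V by (simp add: ennreal_of_nat_eq_real_of_nat ennreal_mult)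
  also have "real m * V \<le> (sample_const \<beta> + 1) * (real n powr (2 * \<beta> + 2) * ln (3 * real n / \<epsilon>)) * V"
    unfolding m_def by (rule mult_right_mono[OF sample_size_bounds(3)[OF \<beta>(1) n \<epsilon>] V])
  also have "\<dots> = cost_const \<alpha> \<beta> K * (real n powr (2 * \<beta> + 2) * ln (3 * real n / \<epsilon>))"
    by (simp add: cost_const_def V_def mult_ac)
  finally show ?thesis by (simp add: m_def ennreal_leI)
qed

lemma good_event:
  assumes \<beta>: "-1/2 \<le> \<beta>" and n: "1 \<le> n" and \<epsilon>: "0 < \<epsilon>" "\<epsilon> < 1"
    and f: "f \<in> L2_space rho" and q: "deg_less n q"
  defines "\<mu> \<equiv> sampling_measure \<beta>" and "m \<equiv> sample_size \<beta> n \<epsilon>"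
  shows "\<exists>A \<in> sets (PiM {..<m} (\<lambda>_. \<mu>)). measure (PiM {..<m} (\<lambda>_. \<mu>)) A \<ge> 1 - \<epsilon> \<and>
    (\<forall>x\<in>A. \<forall>e :: nat \<Rightarrow> complex.
      (\<exists>!p. is_wls_estimator n (weight \<mu>) m x (\<lambda>i. f (x i) + e i) p) \<and>
      (\<forall>p. is_wls_estimator n (weight \<mu>) m x (\<lambda>i. f (x i) + e i) p \<longrightarrow>
        L2_norm rho (\<lambda>t. f t - poly_fun p t) \<le> 36 * (real n / sqrt \<epsilon> *
          (L2_norm rho (\<lambda>t. f t - poly_fun q t) + L2_set (\<lambda>i. cmod (e i)) {..<m})) \<and>
        Linf_norm rho (\<lambda>t. f t - poly_fun p t) \<le> ennreal 36 *
          (Linf_norm rho (\<lambda>t. f t - poly_fun q t) + ennreal (real n / sqrt \<epsilon> *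
          (L2_norm rho (\<lambda>t. f t - poly_fun q t) + L2_set (\<lambda>i. cmod (e i)) {..<m})))))"
proof -
  define g where "g t = (cmod (f t - poly_fun q t))\<^sup>2" for t
  have f_meas: "f \<in> borel_measurable rho" and f_int: "integrable rho (\<lambda>t. (cmod (f t))\<^sup>2)"
    using f by (auto simp: L2_space_def)
  have [measurable]: "f \<in> borel_measurable lebD"
    using f_meas by (simp cong: measurable_cong_sets)
  have g_meas: "g \<in> borel_measurable lebD" unfolding g_def[abs_def] by measurable
  have g_int: "integrable rho g"
  proof (rule Bochner_Integration.integrable_bound)
    show "integrable rho (\<lambda>t. 2 * (cmod (f t))\<^sup>2 + 2 * (cmod (poly_fun q t))\<^sup>2)"
      using f_int integrable_poly_fun[of q] by simp
    show "AE t in rho. norm (g t) \<le> norm (2 * (cmod (f t))\<^sup>2 + 2 * (cmod (poly_fun q t))\<^sup>2)"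
      using cmod_add_square_le[of "f _" "- poly_fun q _"] by (intro AE_I2) (simp add: g_def)
  qed (use g_meas in \<open>simp cong: measurable_cong_sets\<close>)
  define G where "G = (L2_norm rho (\<lambda>t. f t - poly_fun q t))\<^sup>2"
  have "(\<integral>\<^sup>+t. ennreal (g t) \<partial>rho) = ennreal G"
    using g_int by (subst nn_integral_eq_integral) (auto simp: G_def L2_norm_square g_def[abs_def])
  then have g_le: "(\<integral>\<^sup>+t. ennreal (g t) \<partial>rho) \<le> ennreal G" by simp
  have g0: "0 \<le> g t" for t by (simp add: g_def)
  have G0: "0 \<le> G" by (simp add: G_def)
  obtain A where A: "A \<in> sets (PiM {..<m} (\<lambda>_. \<mu>))" "1 - \<epsilon> \<le> measure (PiM {..<m} (\<lambda>_. \<mu>)) A"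
    and good: "\<And>x i. x \<in> A \<Longrightarrow> i < m \<Longrightarrow> weight \<mu> (x i) = jacobi_weight \<beta> (x i)"
      "\<And>x. x \<in> A \<Longrightarrow> (\<Sum>i<m. jacobi_weight \<beta> (x i) * g (x i)) \<le> 4 / \<epsilon> * (real m * G)"
      "\<And>x. x \<in> A \<Longrightarrow> (\<Sum>i<m. jacobi_weight \<beta> (x i)) \<le> 4 / \<epsilon> * real m"
      "\<And>x j s. x \<in> A \<Longrightarrow> j \<in> {1..<10 * n} \<Longrightarrow> s \<in> {1, -1} \<Longrightarrow>
        real m * (node (10 * n) j - node (10 * n) (Suc j))
          \<le> 4 * (\<Sum>i<m. jacobi_weight \<beta> (x i) * indicator (cell (10 * n) j) (s * x i))"
    unfolding \<mu>_def m_def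
    using good_samples[OF \<beta> n \<epsilon> sample_size_bounds(2)[OF \<beta> n \<epsilon>] g_meas g0 g_le G0] by blast
  have m: "0 < m" unfolding m_def using sample_size_bounds(1)[OF \<beta> n \<epsilon>] n by linarith
  show ?thesis
  proof (intro bexI[OF _ A(1)] conjI A(2) ballI allI impI)
    fix x e assume x: "x \<in> A"
    have eq: "(\<Sum>i<m. weight \<mu> (x i) * F i) = (\<Sum>i<m. jacobi_weight \<beta> (x i) * F i)" for F
      using good(1)[OF x] by (intro sum.cong) auto
    have w: "0 \<le> weight \<mu> (x i)" if "i < m" for i
      using good(1)[OF x that] jacobi_weight_nonneg[of \<beta>] \<beta> by simp
    note error = wls_error[of m "weight \<mu>" x n \<epsilon> f q e, OF w m _ \<epsilon> f_meas _ q]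
    have total: "(\<Sum>i<m. weight \<mu> (x i)) \<le> 4 / \<epsilon> * real m"
      using good(3)[OF x] eq[of "\<lambda>_. 1"] by simp
    note prems = n[unfolded One_nat_def Suc_le_eq] g_int[unfolded g_def[abs_def]]
      good(2)[OF x, folded eq, unfolded g_def G_def] total good(4)[OF x, folded eq]
    show "\<exists>!p. is_wls_estimator n (weight \<mu>) m x (\<lambda>i. f (x i) + e i) p"
      by (rule error(1)) (use prems in auto)
    fix p assume p: "is_wls_estimator n (weight \<mu>) m x (\<lambda>i. f (x i) + e i) p"
    have "L2_norm rho (\<lambda>t. f t - poly_fun p t) \<le> 36 * (real n / sqrt \<epsilon> *
          (L2_norm rho (\<lambda>t. f t - poly_fun q t) + L2_set (\<lambda>i. cmod (e i)) {..<m})) \<and>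
        Linf_norm rho (\<lambda>t. f t - poly_fun p t) \<le> ennreal 36 *
          (Linf_norm rho (\<lambda>t. f t - poly_fun q t) + ennreal (real n / sqrt \<epsilon> *
          (L2_norm rho (\<lambda>t. f t - poly_fun q t) + L2_set (\<lambda>i. cmod (e i)) {..<m})))"
      by (rule error(2)) (use prems p in auto)
    then show "L2_norm rho (\<lambda>t. f t - poly_fun p t) \<le> 36 * (real n / sqrt \<epsilon> *
          (L2_norm rho (\<lambda>t. f t - poly_fun q t) + L2_set (\<lambda>i. cmod (e i)) {..<m}))"
      and "Linf_norm rho (\<lambda>t. f t - poly_fun p t) \<le> ennreal 36 *
          (Linf_norm rho (\<lambda>t. f t - poly_fun q t) + ennreal (real n / sqrt \<epsilon> *
          (L2_norm rho (\<lambda>t. f t - poly_fun q t) + L2_set (\<lambda>i. cmod (e i)) {..<m})))"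
      by blast+
  qed
qed

theorem theorem3:
  shows "\<exists>(C :: real) (C1 :: real \<Rightarrow> real \<Rightarrow> real) (C2 :: real \<Rightarrow> real \<Rightarrow> real \<Rightarrow> real).
    C > 0 \<and> (\<forall>\<alpha> K. C1 \<alpha> K > 0) \<and> (\<forall>\<alpha> \<delta> K. C2 \<alpha> \<delta> K > 0) \<and>
    (\<forall>(\<alpha> :: real) (\<delta> :: real) (K :: real) (c :: real \<Rightarrow> real) (n :: nat) (\<epsilon> :: real)
        (f :: real \<Rightarrow> complex) (f\<^sub>n :: complex poly).
      \<alpha> \<ge> 0 \<longrightarrow> \<delta> > 0 \<longrightarrow> K > 0 \<longrightarrow>
      c \<in> borel_measurable (restrict_space borel D) \<longrightarrow>
      (\<forall>x\<in>D. c x > 0) \<longrightarrow>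
      (\<forall>x\<in>D. c x \<le> K * (1 - x\<^sup>2) powr (- \<alpha>)) \<longrightarrow>
      n \<ge> 1 \<longrightarrow> 0 < \<epsilon> \<longrightarrow> \<epsilon> < 1 \<longrightarrow>
      f \<in> L2_space rho \<longrightarrow> is_best_approximation n f f\<^sub>n \<longrightarrow>
      (let \<mu> = sampling_measure (sampling_exponent \<alpha> \<delta>); w = weight \<mu> in
        \<exists>m\<ge>n.
          (\<alpha> < 1/2 \<longrightarrow>
             expected_cost c \<mu> m \<le> ennreal (C1 \<alpha> K * (real n * ln (3 * real n / \<epsilon>)))) \<and>
          (\<alpha> \<ge> 1/2 \<longrightarrow>
             expected_cost c \<mu> m
               \<le> ennreal (C2 \<alpha> \<delta> K * (real n powr (2 * (\<alpha> + \<delta>)) * ln (3 * real n / \<epsilon>)))) \<and>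
          (\<exists>A \<in> sets (PiM {..<m} (\<lambda>_. \<mu>)).
             measure (PiM {..<m} (\<lambda>_. \<mu>)) A \<ge> 1 - \<epsilon> \<and>
             (\<forall>x\<in>A. \<forall>e :: nat \<Rightarrow> complex.
                (\<exists>!p. is_wls_estimator n w m x (\<lambda>i. f (x i) + e i) p) \<and>
                (\<forall>p. is_wls_estimator n w m x (\<lambda>i. f (x i) + e i) p \<longrightarrow>
                   L2_norm rho (\<lambda>t. f t - poly_fun p t)
                     \<le> C * (real n / sqrt \<epsilon> *
                          (L2_norm rho (\<lambda>t. f t - poly_fun f\<^sub>n t) + L2_set (\<lambda>i. cmod (e i)) {..<m})) \<and>
                   Linf_norm rho (\<lambda>t. f t - poly_fun p t)
                     \<le> ennreal C * (Linf_norm rho (\<lambda>t. f t - poly_fun f\<^sub>n t) +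
                          ennreal (real n / sqrt \<epsilon> *
                            (L2_norm rho (\<lambda>t. f t - poly_fun f\<^sub>n t)
                               + L2_set (\<lambda>i. cmod (e i)) {..<m}))))))))"
proof -
  \<comment> \<open>Outside the admissible parameters the value 1 keeps the constants positive,
    which is demanded for all arguments.\<close>
  define C1 where "C1 \<alpha> K =
    (if 0 \<le> \<alpha> \<and> \<alpha> < 1/2 \<and> 0 < K then cost_const \<alpha> (- 1/2) K else 1)" for \<alpha> K :: real
  define C2 where "C2 \<alpha> \<delta> K =
    (if 1/2 \<le> \<alpha> \<and> 0 < \<delta> \<and> 0 < K then cost_const \<alpha> (\<alpha> - 1 + \<delta>) K else 1)" for \<alpha> \<delta> K :: real
  show ?thesis
  proof (rule exI[of _ 36], rule exI[of _ C1], rule exI[of _ C2], intro conjI allI impI, goal_cases)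
    case 1
    show ?case by simp
  next
    case (2 \<alpha> K)
    show ?case by (auto simp: C1_def intro!: cost_const_pos)
  next
    case (3 \<alpha> \<delta> K)
    show ?case by (auto simp: C2_def intro!: cost_const_pos)
  next
    case (4 \<alpha> \<delta> K c n \<epsilon> f f\<^sub>n)
    define \<beta> where "\<beta> = sampling_exponent \<alpha> \<delta>"
    \<comment> \<open>For alpha < 1/2, beta - alpha = -1/2 - alpha > -1; otherwise beta - alpha =
      delta - 1, and delta > 0 decides.\<close>
    have \<beta>: "- 1/2 \<le> \<beta>" "-1 < \<beta> - \<alpha>"
      using 4 by (auto simp: \<beta>_def sampling_exponent_def)
    have q: "deg_less n f\<^sub>n"
      using 4 by (simp add: is_best_approximation_def is_arg_min_def polys_iff)
    have cost: "expected_cost c (sampling_measure \<beta>) (sample_size \<beta> n \<epsilon>) \<le>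
        ennreal (cost_const \<alpha> \<beta> K * (real n powr (2 * \<beta> + 2) * ln (3 * real n / \<epsilon>)))"
      using 4 by (intro expected_cost_le \<beta>) auto
    show ?case
      unfolding Let_def \<beta>_def[symmetric]
    proof (rule exI[of _ "sample_size \<beta> n \<epsilon>"], intro conjI impI)
      show "n \<le> sample_size \<beta> n \<epsilon>"
        using 4 by (intro sample_size_bounds \<beta>) auto
      \<comment> \<open>In this regime 2 beta + 2 = 1; in the next one it equals 2 (alpha +
        delta).\<close>
      show "expected_cost c (sampling_measure \<beta>) (sample_size \<beta> n \<epsilon>) \<le>
          ennreal (C1 \<alpha> K * (real n * ln (3 * real n / \<epsilon>)))" if "\<alpha> < 1/2"
        using cost that 4 by (simp add: C1_def \<beta>_def sampling_exponent_def)
      show "expected_cost c (sampling_measure \<beta>) (sample_size \<beta> n \<epsilon>) \<le>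
          ennreal (C2 \<alpha> \<delta> K * (real n powr (2 * (\<alpha> + \<delta>)) * ln (3 * real n / \<epsilon>)))"
        if "\<alpha> \<ge> 1/2"
        using cost that 4 by (simp add: C2_def \<beta>_def sampling_exponent_def algebra_simps)
    qed (use 4 q \<beta> in \<open>intro good_event; simp\<close>)
  qed
qed

end
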